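(* Let $p\in[2,997]$ be a prime, let $R=\mathbb{F}_p[X]$ and $\pi=X$. Let $A:=(R/\pi^3)(e\xrightarrow{a}f)$ and let \[ \begin{array}{llll} C_1:=A/(\pi^2f), & C_2:=A/(\pi f), & C_3:=A/(\pi^2e,\pi^2f), & C_4:=A/(\pi a),\\ C_5:=A/(\pi a,\pi^2f), & C_6:=A/(\pi^2e), & C_7:=A/(\pi e), & C_8:=A/(\pi^2e,\pi a). \end{array} \] Then for each $j\in\{1,\dots,8\}$ the Heller operator $\Omega:\underline{\mathrm{mod}}\text{-}C_j\to\underline{\mathrm{mod}}\text{-}C_j$ has a left adjoint.
   Context: $A=(R/\pi^3)(e\xrightarrow{a}f)$ is the path algebra over $R/\pi^3$ of the quiver with two vertices $e,f$ (also denoting the corresponding primitive idempotents) and one arrow $a:e\to f$, with $a\in eAf$. Parentheses denote the generated two-sided ideals. $\mathrm{mod}\text{-}C$ is the category of finitely generated right $C$-modules; an $A$-module amounts to a morphism $X\to Y$ of finitely generated $R/\pi^3$-modules (where $X=Me$, $Y=Mf$ and the map is right multiplication by $a$). For a noetherian ring $C$, $\underline{\mathrm{mod}}\text{-}C$ is the factor category of $\mathrm{mod}\text{-}C$ modulo the full additive subcategory of projective modules (morphisms are identified if their difference factors over a projective module). The Heller operator $\Omega:\underline{\mathrm{mod}}\text{-}C\to\underline{\mathrm{mod}}\text{-}C$ is given on objects by choosing for each $X$ a short exact sequence $0\to\Omega X\to \mathrm{P}X\to X\to0$ with $\mathrm{P}X$ finitely generated projective; for $f:X\to Y$ one chooses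 a morphism $(f',\hat f,f)$ between the chosen sequences and sets $\Omega[f]:=[f']$. It is well defined up to isomorphism of functors. *)

theory Defs
  imports "HOL-Algebra.UnivPoly" "HOL-Algebra.QuotRing" "HOL-Number_Theory.Residues"
begin

section \<open>Categories, functors, adjunctions\<close>

text \<open>Hom-sets of different pairs of objects need not be disjoint, so composition and the
  arrow part of a functor carry the objects as arguments.  \<open>Comp C X Y Z g f\<close> is \<open>g\<close> after
  \<open>f\<close> for \<open>f : X \<rightarrow> Y\<close> and \<open>g : Y \<rightarrow> Z\<close>.\<close>

record ('o, 'h) category =
  Obj :: "'o set"
  Hom :: "'o \<Rightarrow> 'o \<Rightarrow> 'h set"
  Ident :: "'o \<Rightarrow> 'h"
  Comp :: "'o \<Rightarrow> 'o \<Rightarrow> 'o \<Rightarrow> 'h \<Rightarrow> 'h \<Rightarrow> 'h"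

locale category =
  fixes C :: "('o, 'h) category"
  assumes Ident_in_Hom: "X \<in> Obj C \<Longrightarrow> Ident C X \<in> Hom C X X"
    and Comp_in_Hom:
      "\<lbrakk>X \<in> Obj C; Y \<in> Obj C; Z \<in> Obj C; f \<in> Hom C X Y; g \<in> Hom C Y Z\<rbrakk>
        \<Longrightarrow> Comp C X Y Z g f \<in> Hom C X Z"
    and Comp_Ident_right:
      "\<lbrakk>X \<in> Obj C; Y \<in> Obj C; f \<in> Hom C X Y\<rbrakk> \<Longrightarrow> Comp C X X Y f (Ident C X) = f"
    and Comp_Ident_left:
      "\<lbrakk>X \<in> Obj C; Y \<in> Obj C; f \<in> Hom C X Y\<rbrakk> \<Longrightarrow> Comp C X Y Y (Ident C Y) f = f"
    and Comp_assoc: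
      "\<lbrakk>W \<in> Obj C; X \<in> Obj C; Y \<in> Obj C; Z \<in> Obj C;
        f \<in> Hom C W X; g \<in> Hom C X Y; h \<in> Hom C Y Z\<rbrakk>
        \<Longrightarrow> Comp C W Y Z h (Comp C W X Y g f) = Comp C W X Z (Comp C X Y Z h g) f"

record ('o1, 'h1, 'o2, 'h2) cat_functor =
  on_obj :: "'o1 \<Rightarrow> 'o2"
  on_mor :: "'o1 \<Rightarrow> 'o1 \<Rightarrow> 'h1 \<Rightarrow> 'h2"

locale is_functor = dom: category C + cod: category D
  for C :: "('o1, 'h1) category" and D :: "('o2, 'h2) category"
    and F :: "('o1, 'h1, 'o2, 'h2) cat_functor" +
  assumes on_obj_in_Obj: "X \<in> Obj C \<Longrightarrow> on_obj F X \<in> Obj D"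
    and on_mor_in_Hom:
      "\<lbrakk>X \<in> Obj C; Y \<in> Obj C; f \<in> Hom C X Y\<rbrakk>
        \<Longrightarrow> on_mor F X Y f \<in> Hom D (on_obj F X) (on_obj F Y)"
    and on_mor_Ident: "X \<in> Obj C \<Longrightarrow> on_mor F X X (Ident C X) = Ident D (on_obj F X)"
    and on_mor_Comp:
      "\<lbrakk>X \<in> Obj C; Y \<in> Obj C; Z \<in> Obj C; f \<in> Hom C X Y; g \<in> Hom C Y Z\<rbrakk>
        \<Longrightarrow> on_mor F X Z (Comp C X Y Z g f)
          = Comp D (on_obj F X) (on_obj F Y) (on_obj F Z) (on_mor F Y Z g) (on_mor F X Y f)"

text \<open>\<open>F : D \<rightarrow> C\<close> is left adjoint to \<open>G : C \<rightarrow> D\<close> via bijections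
  \<open>\<Phi> X Y : Hom C (F X) Y \<rightarrow> Hom D X (G Y)\<close>, natural in \<open>X\<close> and in \<open>Y\<close>.\<close>

locale adjunction = left: is_functor D C F + right: is_functor C D G
  for C :: "('o1, 'h1) category" and D :: "('o2, 'h2) category"
    and F :: "('o2, 'h2, 'o1, 'h1) cat_functor" and G :: "('o1, 'h1, 'o2, 'h2) cat_functor"
    and \<Phi> :: "'o2 \<Rightarrow> 'o1 \<Rightarrow> 'h1 \<Rightarrow> 'h2" +
  assumes bij:
      "\<lbrakk>X \<in> Obj D; Y \<in> Obj C\<rbrakk>
        \<Longrightarrow> bij_betw (\<Phi> X Y) (Hom C (on_obj F X) Y) (Hom D X (on_obj G Y))"
    and natural_left:
      "\<lbrakk>X' \<in> Obj D; X \<in> Obj D; Y \<in> Obj C; k \<in> Hom D X' X; u \<in> Hom C (on_obj F X) Y\<rbrakk>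
        \<Longrightarrow> \<Phi> X' Y (Comp C (on_obj F X') (on_obj F X) Y u (on_mor F X' X k))
          = Comp D X' X (on_obj G Y) (\<Phi> X Y u) k"
    and natural_right:
      "\<lbrakk>X \<in> Obj D; Y \<in> Obj C; Y' \<in> Obj C; u \<in> Hom C (on_obj F X) Y; h \<in> Hom C Y Y'\<rbrakk>
        \<Longrightarrow> \<Phi> X Y' (Comp C (on_obj F X) Y Y' h u)
          = Comp D X (on_obj G Y) (on_obj G Y') (on_mor G Y Y' h) (\<Phi> X Y u)"

definition has_left_adjoint ::
    "('o1, 'h1) category \<Rightarrow> ('o2, 'h2) category \<Rightarrow> ('o1, 'h1, 'o2, 'h2) cat_functor \<Rightarrow> bool"
  where "has_left_adjoint C D G \<longleftrightarrow> (\<exists>F \<Phi>. adjunction C D F G \<Phi>)"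


section \<open>Right modules\<close>

text \<open>The record \<^type>\<open>module\<close> of the library is used for right modules over a possibly
  noncommutative ring: \<open>r \<odot> x\<close> stands for the right action \<open>x\<cdot>r\<close>.  The record's
  multiplication and unit are ignored.\<close>

locale right_module = R?: ring R + M?: abelian_group M
  for R :: "'a ring" and M :: "('a, 'm) module" (structure) +
  assumes act_closed: "\<lbrakk>r \<in> carrier R; x \<in> carrier M\<rbrakk> \<Longrightarrow> r \<odot>\<^bsub>M\<^esub> x \<in> carrier M"
    and act_add_ring:
      "\<lbrakk>r \<in> carrier R; s \<in> carrier R; x \<in> carrier M\<rbrakk>
        \<Longrightarrow> (r \<oplus>\<^bsub>R\<^esub> s) \<odot>\<^bsub>M\<^esub> x = r \<odot>\<^bsub>M\<^esub> x \<oplus>\<^bsub>M\<^esub> s \<odot>\<^bsub>M\<^esub> x"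
    and act_add_module:
      "\<lbrakk>r \<in> carrier R; x \<in> carrier M; y \<in> carrier M\<rbrakk>
        \<Longrightarrow> r \<odot>\<^bsub>M\<^esub> (x \<oplus>\<^bsub>M\<^esub> y) = r \<odot>\<^bsub>M\<^esub> x \<oplus>\<^bsub>M\<^esub> r \<odot>\<^bsub>M\<^esub> y"
    and act_mult:
      "\<lbrakk>r \<in> carrier R; s \<in> carrier R; x \<in> carrier M\<rbrakk>
        \<Longrightarrow> (r \<otimes>\<^bsub>R\<^esub> s) \<odot>\<^bsub>M\<^esub> x = s \<odot>\<^bsub>M\<^esub> (r \<odot>\<^bsub>M\<^esub> x)"
    and act_one: "x \<in> carrier M \<Longrightarrow> \<one>\<^bsub>R\<^esub> \<odot>\<^bsub>M\<^esub> x = x"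

definition fin_gen_module :: "'a ring \<Rightarrow> ('a, 'm) module \<Rightarrow> bool"
  where "fin_gen_module R M \<longleftrightarrow>
    (\<exists>B. finite B \<and> B \<subseteq> carrier M \<and>
      (\<forall>x\<in>carrier M. \<exists>c. c \<in> B \<rightarrow> carrier R \<and> x = (\<Oplus>\<^bsub>M\<^esub>b\<in>B. c b \<odot>\<^bsub>M\<^esub> b)))"

text \<open>The carriers are subsets of a type \<open>'m\<close>.  If \<open>R\<close> is finite, then so is every finitely
  generated module, hence for infinite \<open>'m\<close> every isomorphism class of finitely generated
  modules is represented here, and projectivity within \<open>'m\<close> is the usual one for these
  modules.\<close>

definition fg_modules :: "'a ring \<Rightarrow> ('a, 'm) module set"
  where "fg_modules R = {M. right_module R M \<and> fin_gen_module R M}"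

definition mod_hom :: "'a ring \<Rightarrow> ('a, 'm) module \<Rightarrow> ('a, 'm) module \<Rightarrow> ('m \<Rightarrow> 'm) set"
  where "mod_hom R M N =
    {h \<in> carrier M \<rightarrow>\<^sub>E carrier N.
      (\<forall>x\<in>carrier M. \<forall>y\<in>carrier M. h (x \<oplus>\<^bsub>M\<^esub> y) = h x \<oplus>\<^bsub>N\<^esub> h y) \<and>
      (\<forall>r\<in>carrier R. \<forall>x\<in>carrier M. h (r \<odot>\<^bsub>M\<^esub> x) = r \<odot>\<^bsub>N\<^esub> h x)}"

definition projective_module :: "'a ring \<Rightarrow> ('a, 'm) module \<Rightarrow> bool"
  where "projective_module R P \<longleftrightarrow> right_module R P \<and>
    (\<forall>(M :: ('a, 'm) module) N. \<forall>g \<in> mod_hom R M N. \<forall>f \<in> mod_hom R P N.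
      right_module R M \<longrightarrow> right_module R N \<longrightarrow> g ` carrier M = carrier N \<longrightarrow>
      (\<exists>h \<in> mod_hom R P M. \<forall>x\<in>carrier P. g (h x) = f x))"


section \<open>The stable module category\<close>

definition stable_rel ::
    "'a ring \<Rightarrow> ('a, 'm) module \<Rightarrow> ('a, 'm) module \<Rightarrow> (('m \<Rightarrow> 'm) \<times> ('m \<Rightarrow> 'm)) set"
  where "stable_rel R X Y =
    {(f, g). f \<in> mod_hom R X Y \<and> g \<in> mod_hom R X Y \<and>
      (\<exists>P \<in> fg_modules R. projective_module R P \<and>
        (\<exists>u \<in> mod_hom R X P. \<exists>v \<in> mod_hom R P Y.
          \<forall>x\<in>carrier X. f x \<ominus>\<^bsub>Y\<^esub> g x = v (u x)))}"

definition stable_class ::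
    "'a ring \<Rightarrow> ('a, 'm) module \<Rightarrow> ('a, 'm) module \<Rightarrow> ('m \<Rightarrow> 'm) \<Rightarrow> ('m \<Rightarrow> 'm) set"
  where "stable_class R X Y f = stable_rel R X Y `` {f}"

definition stable_mod :: "'a ring \<Rightarrow> (('a, 'm) module, ('m \<Rightarrow> 'm) set) category"
  where "stable_mod R =
    \<lparr>Obj = fg_modules R,
     Hom = (\<lambda>X Y. mod_hom R X Y // stable_rel R X Y),
     Ident = (\<lambda>X. stable_class R X X (\<lambda>x\<in>carrier X. x)),
     Comp = (\<lambda>X Y Z G F. \<Union>g\<in>G. \<Union>f\<in>F. stable_class R X Z (compose (carrier X) g f))\<rparr>"


section \<open>The Heller operator\<close>

text \<open>A choice, for each module \<open>X\<close>, of a sequence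
  \<open>syz X \<rightarrow> cov X \<rightarrow> X\<close> with maps \<open>inc X\<close> and \<open>prj X\<close>.\<close>

record ('a, 'm) syzygies =
  syz :: "('a, 'm) module \<Rightarrow> ('a, 'm) module"
  cov :: "('a, 'm) module \<Rightarrow> ('a, 'm) module"
  inc :: "('a, 'm) module \<Rightarrow> 'm \<Rightarrow> 'm"
  prj :: "('a, 'm) module \<Rightarrow> 'm \<Rightarrow> 'm"

definition short_exact ::
    "'a ring \<Rightarrow> ('a, 'm) module \<Rightarrow> ('m \<Rightarrow> 'm) \<Rightarrow> ('a, 'm) module \<Rightarrow> ('m \<Rightarrow> 'm)
      \<Rightarrow> ('a, 'm) module \<Rightarrow> bool"
  where "short_exact R K i P q X \<longleftrightarrow>
    i \<in> mod_hom R K P \<and> q \<in> mod_hom R P X \<and>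
    inj_on i (carrier K) \<and> q ` carrier P = carrier X \<and>
    i ` carrier K = {x \<in> carrier P. q x = \<zero>\<^bsub>X\<^esub>}"

definition syzygy_choice :: "'a ring \<Rightarrow> ('a, 'm) syzygies \<Rightarrow> bool"
  where "syzygy_choice R S \<longleftrightarrow>
    (\<forall>X \<in> fg_modules R. syz S X \<in> fg_modules R \<and> cov S X \<in> fg_modules R \<and>
      projective_module R (cov S X) \<and>
      short_exact R (syz S X) (inc S X) (cov S X) (prj S X) X)"

definition ses_morphism ::
    "'a ring \<Rightarrow> ('a, 'm) syzygies \<Rightarrow> ('a, 'm) module \<Rightarrow> ('a, 'm) module
      \<Rightarrow> ('m \<Rightarrow> 'm) \<Rightarrow> ('m \<Rightarrow> 'm) \<Rightarrow> ('m \<Rightarrow> 'm) \<Rightarrow> bool"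
  where "ses_morphism R S X Y f' fh f \<longleftrightarrow>
    f' \<in> mod_hom R (syz S X) (syz S Y) \<and>
    fh \<in> mod_hom R (cov S X) (cov S Y) \<and>
    f \<in> mod_hom R X Y \<and>
    (\<forall>x\<in>carrier (syz S X). fh (inc S X x) = inc S Y (f' x)) \<and>
    (\<forall>x\<in>carrier (cov S X). f (prj S X x) = prj S Y (fh x))"

text \<open>The class obtained does not depend on the representative \<open>f\<close> of \<open>F\<close> nor on the
  chosen morphism of sequences extending it.\<close>

definition heller ::
    "'a ring \<Rightarrow> ('a, 'm) syzygies
      \<Rightarrow> (('a, 'm) module, ('m \<Rightarrow> 'm) set, ('a, 'm) module, ('m \<Rightarrow> 'm) set) cat_functor"
  where "heller R S =
    \<lparr>on_obj = syz S,
     on_mor = (\<lambda>X Y F. stable_class R (syz S X) (syz S Y)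
       (SOME f'. \<exists>f\<in>F. \<exists>fh. ses_morphism R S X Y f' fh f))\<rparr>"


section \<open>The algebras\<close>

text \<open>The paths of the quiver with vertices \<open>e\<close>, \<open>f\<close> and one arrow \<open>a : e \<rightarrow> f\<close>.
  Paths are composed from left to right, so that \<open>a = e a f\<close>.\<close>

datatype path = Pe | Pf | Pa

fun path_comp :: "path \<Rightarrow> path \<Rightarrow> path option" where
  "path_comp Pe Pe = Some Pe"
| "path_comp Pe Pa = Some Pa"
| "path_comp Pa Pf = Some Pa"
| "path_comp Pf Pf = Some Pf"
| "path_comp _ _ = None"

text \<open>Elements are the coefficient functions of linear combinations of paths.\<close>

definition path_algebra :: "'s ring \<Rightarrow> (path \<Rightarrow> 's) ring"
  where "path_algebra S =
    \<lparr>carrier = {x. \<forall>w. x w \<in> carrier S},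
     monoid.mult = (\<lambda>x y w. \<Oplus>\<^bsub>S\<^esub>q\<in>{(u, v). path_comp u v = Some w}. x (fst q) \<otimes>\<^bsub>S\<^esub> y (snd q)),
     one = (\<lambda>w. if w = Pa then \<zero>\<^bsub>S\<^esub> else \<one>\<^bsub>S\<^esub>),
     zero = (\<lambda>w. \<zero>\<^bsub>S\<^esub>),
     add = (\<lambda>x y w. x w \<oplus>\<^bsub>S\<^esub> y w)\<rparr>"

definition path_elem :: "'s ring \<Rightarrow> 's \<Rightarrow> path \<Rightarrow> (path \<Rightarrow> 's)"
  where "path_elem S c w = (\<lambda>v. if v = w then c else \<zero>\<^bsub>S\<^esub>)"

type_synonym scalar = "(nat \<Rightarrow> int) set"

definition poly_Fp :: "nat \<Rightarrow> (int, nat \<Rightarrow> int) up_ring"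
  where "poly_Fp p = UP (residue_ring (int p))"

definition poly_X :: "nat \<Rightarrow> nat \<Rightarrow> int"
  where "poly_X p = monom (poly_Fp p) \<one>\<^bsub>residue_ring (int p)\<^esub> 1"

definition pi_cubed :: "nat \<Rightarrow> (nat \<Rightarrow> int) set"
  where "pi_cubed p = PIdl\<^bsub>poly_Fp p\<^esub> (poly_X p [^]\<^bsub>poly_Fp p\<^esub> (3::nat))"

definition scalars :: "nat \<Rightarrow> scalar ring"
  where "scalars p = poly_Fp p Quot pi_cubed p"

definition pi_class :: "nat \<Rightarrow> scalar"
  where "pi_class p = pi_cubed p +>\<^bsub>poly_Fp p\<^esub> poly_X p"

definition A_alg :: "nat \<Rightarrow> (path \<Rightarrow> scalar) ring"
  where "A_alg p = path_algebra (scalars p)"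

definition pi_path :: "nat \<Rightarrow> nat \<Rightarrow> path \<Rightarrow> (path \<Rightarrow> scalar)"
  where "pi_path p k w = path_elem (scalars p) (pi_class p [^]\<^bsub>scalars p\<^esub> k) w"

definition relators :: "nat \<Rightarrow> nat \<Rightarrow> (path \<Rightarrow> scalar) set"
  where "relators p j =
    (if j = 1 then {pi_path p 2 Pf}
     else if j = 2 then {pi_path p 1 Pf}
     else if j = 3 then {pi_path p 2 Pe, pi_path p 2 Pf}
     else if j = 4 then {pi_path p 1 Pa}
     else if j = 5 then {pi_path p 1 Pa, pi_path p 2 Pf}
     else if j = 6 then {pi_path p 2 Pe}
     else if j = 7 then {pi_path p 1 Pe}
     else if j = 8 then {pi_path p 2 Pe, pi_path p 1 Pa}
     else {})"

definition C_alg :: "nat \<Rightarrow> nat \<Rightarrow> (path \<Rightarrow> scalar) set ring"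
  where "C_alg p j = A_alg p Quot (Idl\<^bsub>A_alg p\<^esub> (relators p j))"

end

theory Submission
  imports Defs
begin

text \<open>The argument works for every finite ring and goes back to Auslander and Reiten: the left
  adjoint is \<open>Tr \<Omega> Tr\<close>.  Let \<open>i : X \<rightarrow> P\<close> be a left approximation by projectives, that is, every
  map from \<open>X\<close> to a finitely generated projective factors through \<open>i\<close>, and let \<open>q : P \<rightarrow> Z\<close> be
  the cokernel of \<open>i\<close>.  Given \<open>0 \<rightarrow> \<Omega> Y \<rightarrow> Q \<rightarrow> Y \<rightarrow> 0\<close>, a map \<open>X \<rightarrow> \<Omega> Y \<rightarrow> Q\<close> extends to \<open>P \<rightarrow> Q\<close>
  and so induces \<open>Z \<rightarrow> Y\<close>; conversely a map \<open>Z \<rightarrow> Y\<close> lifts to \<open>P \<rightarrow> Q\<close>, and the restriction of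
  the lift to \<open>X\<close> lands in \<open>\<Omega> Y\<close>.  Modulo projectives these constructions are mutually inverse;
  the map \<open>\<eta> : X \<rightarrow> \<Omega> Z\<close> obtained from the identity of \<open>Z\<close> is a universal arrow.\<close>

section \<open>Module homomorphisms\<close>

text \<open>In classical terms, generators of the left module X^* = Hom(X, R) give a surjection R^n
  -> X^*; dualizing it yields X -> X^** -> R^n, and the cokernel of this composite is
  \<open>Tr \<Omega> Tr X\<close> up to projective summands. Here all elements of X^* serve as
  generators, which is possible because over a finite ring a finitely generated module and its dual
  are finite sets. Since i may have a kernel, X need not be the syzygy of Z; \<eta> only compares
  the two, and this suffices because maps from X to projectives see X only modulo the kernel of i. A
  second constraint comes from the types: objects of the stable category are carried by subsets of
  one type \<open>'m\<close>, and projectivity is a lifting property against modules of that type.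
  Cokernels are therefore realized on representatives, and free modules, whose elements are
  functions, are replaced by copies inside \<open>'m\<close>. Finally, Z is constructed for each X
  separately, without functoriality; the passage from X to Z becomes a functor only through the
  uniqueness of universal arrows.\<close>

definition right_hom ::
    "'a ring \<Rightarrow> ('a, 'm) module \<Rightarrow> ('a, 'n) module \<Rightarrow> ('m \<Rightarrow> 'n) \<Rightarrow> bool"
  where "right_hom R M N h \<longleftrightarrow> h \<in> carrier M \<rightarrow> carrier N \<and>
    (\<forall>x\<in>carrier M. \<forall>y\<in>carrier M. h (x \<oplus>\<^bsub>M\<^esub> y) = h x \<oplus>\<^bsub>N\<^esub> h y) \<and>
    (\<forall>r\<in>carrier R. \<forall>x\<in>carrier M. h (r \<odot>\<^bsub>M\<^esub> x) = r \<odot>\<^bsub>N\<^esub> h x)"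

lemma right_homI:
  assumes "\<And>x. x \<in> carrier M \<Longrightarrow> h x \<in> carrier N"
    and "\<And>x y. x \<in> carrier M \<Longrightarrow> y \<in> carrier M \<Longrightarrow> h (x \<oplus>\<^bsub>M\<^esub> y) = h x \<oplus>\<^bsub>N\<^esub> h y"
    and "\<And>r x. r \<in> carrier R \<Longrightarrow> x \<in> carrier M \<Longrightarrow> h (r \<odot>\<^bsub>M\<^esub> x) = r \<odot>\<^bsub>N\<^esub> h x"
  shows "right_hom R M N h"
  using assms by (auto simp: right_hom_def)

lemma
  assumes "right_hom R M N h"
  shows right_hom_closed: "x \<in> carrier M \<Longrightarrow> h x \<in> carrier N"
    and right_hom_add:
      "x \<in> carrier M \<Longrightarrow> y \<in> carrier M \<Longrightarrow> h (x \<oplus>\<^bsub>M\<^esub> y) = h x \<oplus>\<^bsub>N\<^esub> h y"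
    and right_hom_act: "r \<in> carrier R \<Longrightarrow> x \<in> carrier M \<Longrightarrow> h (r \<odot>\<^bsub>M\<^esub> x) = r \<odot>\<^bsub>N\<^esub> h x"
  using assms by (auto simp: right_hom_def)

text \<open>\<open>right_hom\<close> relaxes \<open>mod_hom\<close> in two ways: source and target
  may have different element types, and nothing is fixed outside the carrier. Maps between a module
  on \<open>'m\<close> and a module of coordinate vectors require both.\<close>

lemma mod_hom_iff: "h \<in> mod_hom R M N \<longleftrightarrow> h \<in> extensional (carrier M) \<and> right_hom R M N h"
  by (auto simp: mod_hom_def right_hom_def PiE_def)

lemma mod_hom_right_hom: "h \<in> mod_hom R M N \<Longrightarrow> right_hom R M N h"
  by (simp add: mod_hom_iff)

lemmas mod_hom_closed = right_hom_closed[OF mod_hom_right_hom]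
  and mod_hom_add = right_hom_add[OF mod_hom_right_hom]
  and mod_hom_act = right_hom_act[OF mod_hom_right_hom]

lemma right_module_abelian_group: "right_module R M \<Longrightarrow> abelian_group M"
  by (simp add: right_module_def)

lemma right_hom_restrict:
  assumes "right_module R M" and "right_hom R M N h"
  shows "restrict h (carrier M) \<in> mod_hom R M N"
proof -
  interpret M: right_module R M by fact
  show ?thesis
    using assms(2) by (auto simp: mod_hom_iff right_hom_def M.act_closed)
qed

lemma mod_hom_eqI:
  assumes "right_module R M" "\<And>x. x \<in> carrier M \<Longrightarrow> f x \<in> carrier N"
    and "\<And>x y. x \<in> carrier M \<Longrightarrow> y \<in> carrier M \<Longrightarrow> f (x \<oplus>\<^bsub>M\<^esub> y) = f x \<oplus>\<^bsub>N\<^esub> f y"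
    and "\<And>r x. r \<in> carrier R \<Longrightarrow> x \<in> carrier M \<Longrightarrow> f (r \<odot>\<^bsub>M\<^esub> x) = r \<odot>\<^bsub>N\<^esub> f x"
  shows "(\<lambda>x\<in>carrier M. f x) \<in> mod_hom R M N"
  by (rule right_hom_restrict[OF assms(1) right_homI]) (use assms in auto)

lemma right_hom_abelian_group_hom:
  assumes "abelian_group M" and "abelian_group N" and "right_hom R M N h"
  shows "abelian_group_hom M N h"
  using assms
  by (auto simp: abelian_group_hom_def abelian_group_hom_axioms_def group_hom_def
      group_hom_axioms_def hom_def right_hom_def abelian_group.a_group)

lemma right_hom_zero:
  assumes "abelian_group M" and "abelian_group N" and "right_hom R M N h"
  shows "h \<zero>\<^bsub>M\<^esub> = \<zero>\<^bsub>N\<^esub>"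
  by (rule abelian_group_hom.hom_zero[OF right_hom_abelian_group_hom[OF assms]])

lemma right_hom_minus:
  assumes "abelian_group M" and "abelian_group N" and "right_hom R M N h"
    and "x \<in> carrier M" "y \<in> carrier M"
  shows "h (x \<ominus>\<^bsub>M\<^esub> y) = h x \<ominus>\<^bsub>N\<^esub> h y"
proof -
  interpret abelian_group_hom M N h by (rule right_hom_abelian_group_hom) fact+
  show ?thesis using assms by (simp add: a_minus_def hom_a_inv)
qed

lemma right_hom_finsum:
  assumes "abelian_group M" and "abelian_group N" and "right_hom R M N h"
    and "finite I" and "v \<in> I \<rightarrow> carrier M"
  shows "h (\<Oplus>\<^bsub>M\<^esub>i\<in>I. v i) = (\<Oplus>\<^bsub>N\<^esub>i\<in>I. h (v i))"
proof -
  interpret M: abelian_group M by fact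
  interpret N: abelian_group N by fact
  show ?thesis using assms(4,5)
  proof (induction I)
    case empty
    then show ?case using right_hom_zero[OF assms(1-3)] by simp
  next
    case (insert i I)
    then have "h (v j) \<in> carrier N" if "j \<in> insert i I" for j
      using right_hom_closed[OF assms(3)] that by auto
    with insert show ?case
      by (simp add: right_hom_add[OF assms(3)] Pi_iff)
  qed
qed

lemma compose_mod_hom:
  assumes "right_module R X" "f \<in> mod_hom R X Y" and "g \<in> mod_hom R Y Z"
  shows "compose (carrier X) g f \<in> mod_hom R X Z"
  unfolding compose_def
  by (rule mod_hom_eqI[OF assms(1)])
    (use assms(2,3) in \<open>simp_all add: mod_hom_closed mod_hom_add mod_hom_act\<close>)

lemma ident_mod_hom:
  assumes "right_module R X"
  shows "(\<lambda>x\<in>carrier X. x) \<in> mod_hom R X X"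
  by (rule mod_hom_eqI[OF assms]) auto

section \<open>Arithmetic of zero and differences in modules\<close>

lemma (in right_module) act_zero:
  assumes "r \<in> carrier R"
  shows "r \<odot>\<^bsub>M\<^esub> \<zero>\<^bsub>M\<^esub> = \<zero>\<^bsub>M\<^esub>"
  using act_add_module[of r "\<zero>\<^bsub>M\<^esub>" "\<zero>\<^bsub>M\<^esub>"] assms
  by (metis M.add.l_cancel_one M.r_zero M.zero_closed act_closed)

lemma (in right_module) zero_act:
  assumes "x \<in> carrier M"
  shows "\<zero>\<^bsub>R\<^esub> \<odot>\<^bsub>M\<^esub> x = \<zero>\<^bsub>M\<^esub>"
  using act_add_ring[of "\<zero>\<^bsub>R\<^esub>" "\<zero>\<^bsub>R\<^esub>" x] assms
  by (metis M.add.l_cancel_one R.r_zero R.zero_closed act_closed)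

lemma (in right_module) act_minus:
  assumes "r \<in> carrier R" "x \<in> carrier M"  "y \<in> carrier M"
  shows "r \<odot>\<^bsub>M\<^esub> (x \<ominus>\<^bsub>M\<^esub> y) = r \<odot>\<^bsub>M\<^esub> x \<ominus>\<^bsub>M\<^esub> r \<odot>\<^bsub>M\<^esub> y"
proof -
  have "r \<odot>\<^bsub>M\<^esub> (x \<ominus>\<^bsub>M\<^esub> y) \<oplus>\<^bsub>M\<^esub> r \<odot>\<^bsub>M\<^esub> y = r \<odot>\<^bsub>M\<^esub> x"
    using assms
    by (simp add: act_add_module[symmetric] M.minus_closed)
       (simp add: M.minus_eq M.a_assoc M.l_neg)
  then show ?thesis
    using assms by (metis M.add.inv_solve_right M.minus_eq M.minus_closed act_closed)
qed

lemma (in abelian_group) minus_add_minus: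
  assumes "a \<in> carrier G" "b \<in> carrier G" "c \<in> carrier G" "d \<in> carrier G"
  shows "(a \<oplus> b) \<ominus> (c \<oplus> d) = (a \<ominus> c) \<oplus> (b \<ominus> d)"
  using assms by (simp add: minus_eq minus_add a_ac)

lemma (in abelian_group) minus_eq_zero_iff:
  assumes "a \<in> carrier G" "b \<in> carrier G"
  shows "a \<ominus> b = \<zero> \<longleftrightarrow> a = b"
  using assms by (metis a_minus_def add.inv_closed minus_equality minus_minus r_neg)

lemma (in abelian_group) minus_telescope:
  assumes "a \<in> carrier G" "b \<in> carrier G" "c \<in> carrier G"
  shows "(a \<ominus> b) \<oplus> (b \<ominus> c) = a \<ominus> c"
proof -
  have "(a \<ominus> b) \<oplus> (b \<ominus> c) = a \<oplus> (\<ominus> b \<oplus> b) \<oplus> \<ominus> c"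
    using assms by (simp only: minus_eq a_assoc a_closed a_inv_closed)
  then show ?thesis using assms by (simp add: l_neg minus_eq)
qed

lemma diff_mod_hom:
  assumes "right_module R X" "right_module R Y" "f \<in> mod_hom R X Y" and "g \<in> mod_hom R X Y"
  shows "(\<lambda>x\<in>carrier X. f x \<ominus>\<^bsub>Y\<^esub> g x) \<in> mod_hom R X Y"
proof -
  interpret Y: right_module R Y by fact
  show ?thesis
    by (rule mod_hom_eqI[OF assms(1)])
      (use assms(3,4) in \<open>simp_all add: mod_hom_closed mod_hom_add mod_hom_act
        Y.M.minus_add_minus Y.act_minus Y.M.minus_closed\<close>)
qed

lemma add_mod_hom:
  assumes "right_module R X" "right_module R Y" "f \<in> mod_hom R X Y" and "g \<in> mod_hom R X Y"
  shows "(\<lambda>x\<in>carrier X. f x \<oplus>\<^bsub>Y\<^esub> g x) \<in> mod_hom R X Y"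
proof -
  interpret Y: right_module R Y by fact
  show ?thesis
    by (rule mod_hom_eqI[OF assms(1)])
      (use assms(3,4) in \<open>simp_all add: mod_hom_closed mod_hom_add mod_hom_act
        Y.M.a_ac Y.act_add_module\<close>)
qed

lemma zero_mod_hom:
  assumes "right_module R X" "right_module R Y"
  shows "(\<lambda>x\<in>carrier X. \<zero>\<^bsub>Y\<^esub>) \<in> mod_hom R X Y"
proof -
  interpret Y: right_module R Y by fact
  show ?thesis by (intro mod_hom_eqI[OF assms(1)]) (auto simp: Y.act_zero)
qed

lemma projective_lift:
  assumes "projective_module R P" and "g \<in> mod_hom R M N" and "f \<in> mod_hom R P N"
    and "right_module R M" "right_module R N" and "g ` carrier M = carrier N"
  obtains h where "h \<in> mod_hom R P M" and "\<And>x. x \<in> carrier P \<Longrightarrow> g (h x) = f x"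
  using assms(1)[unfolded projective_module_def, THEN conjunct2, rule_format, OF assms(2-6)] that
  by blast


section \<open>Kernels and cokernels\<close>

text \<open>Universal property of the kernel. The map \<open>s\<close> is \<open>g\<close> followed
  by the inverse of the injection \<open>i\<close>; its linearity is checked after applying
  \<open>i\<close>, where it becomes linearity of \<open>g\<close>.\<close>

lemma kernel_lift:
  assumes "short_exact R K i P q X" and "right_module R W" "right_module R K"
    and "g \<in> mod_hom R W P" and "\<And>x. x \<in> carrier W \<Longrightarrow> q (g x) = \<zero>\<^bsub>X\<^esub>"
  obtains s where "s \<in> mod_hom R W K" and "\<And>x. x \<in> carrier W \<Longrightarrow> i (s x) = g x"
proof -
  interpret K: right_module R K by fact
  have i: "i \<in> mod_hom R K P" and inj: "inj_on i (carrier K)"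
    and im: "i ` carrier K = {x \<in> carrier P. q x = \<zero>\<^bsub>X\<^esub>}"
    using assms(1) by (auto simp: short_exact_def)
  define s where "s = (\<lambda>x\<in>carrier W. inv_into (carrier K) i (g x))"
  interpret W: right_module R W by fact
  have mem: "g x \<in> i ` carrier K" if "x \<in> carrier W" for x
    unfolding im using that assms(4,5) by (auto simp: mod_hom_closed)
  then have s: "s x \<in> carrier K" "i (s x) = g x" if "x \<in> carrier W" for x
    using that by (simp_all add: s_def inv_into_into f_inv_into_f)
  have "s \<in> mod_hom R W K"
    unfolding mod_hom_iff
  proof (intro conjI right_homI)
    show "s \<in> extensional (carrier W)" by (simp add: s_def)
    show "s x \<in> carrier K" if "x \<in> carrier W" for x using s that by simp
    show "s (x \<oplus>\<^bsub>W\<^esub> y) = s x \<oplus>\<^bsub>K\<^esub> s y" if "x \<in> carrier W" "y \<in> carrier W" for x y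
      using that by - (rule inj_onD[OF inj],
        simp_all add: s mod_hom_add[OF i] mod_hom_add[OF assms(4)])
    show "s (r \<odot>\<^bsub>W\<^esub> x) = r \<odot>\<^bsub>K\<^esub> s x" if "r \<in> carrier R" "x \<in> carrier W" for r x
      using that by - (rule inj_onD[OF inj],
        simp_all add: s mod_hom_act[OF i] mod_hom_act[OF assms(4)] W.act_closed K.act_closed)
  qed
  with s show thesis by (intro that[of s]) auto
qed

text \<open>Two preimages of one element of \<open>Z\<close> differ by an element of the kernel of
  \<open>q\<close>, which \<open>g\<close> kills; hence evaluating \<open>g\<close> at an arbitrary
  preimage defines \<open>h\<close>.\<close>

lemma cokernel_factor:
  assumes "right_module R P" "right_module R Z" "right_module R Y"
    and "q \<in> mod_hom R P Z" "q ` carrier P = carrier Z" and "g \<in> mod_hom R P Y"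
    and ker: "\<And>x. x \<in> carrier P \<Longrightarrow> q x = \<zero>\<^bsub>Z\<^esub> \<Longrightarrow> g x = \<zero>\<^bsub>Y\<^esub>"
  obtains h where "h \<in> mod_hom R Z Y" and "\<And>x. x \<in> carrier P \<Longrightarrow> h (q x) = g x"
proof -
  interpret P: right_module R P by fact
  interpret Z: right_module R Z by fact
  interpret Y: right_module R Y by fact
  note q = mod_hom_right_hom[OF assms(4)] and g = mod_hom_right_hom[OF assms(6)]
  have eq: "g x = g y" if "x \<in> carrier P" "y \<in> carrier P" "q x = q y" for x y
  proof -
    have "q (x \<ominus>\<^bsub>P\<^esub> y) = \<zero>\<^bsub>Z\<^esub>"
      using that right_hom_minus[OF P.M.abelian_group_axioms Z.M.abelian_group_axioms q]
        right_hom_closed[OF q] by (simp add: Z.M.minus_eq Z.M.r_neg)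
    then have "g (x \<ominus>\<^bsub>P\<^esub> y) = \<zero>\<^bsub>Y\<^esub>"
      using ker that by (simp add: P.M.minus_closed)
    then show ?thesis
      using that right_hom_minus[OF P.M.abelian_group_axioms Y.M.abelian_group_axioms g]
        right_hom_closed[OF g] by (simp add: Y.M.minus_eq_zero_iff)
  qed
  define h where "h = (\<lambda>z\<in>carrier Z. g (inv_into (carrier P) q z))"
  have h: "h (q x) = g x" if "x \<in> carrier P" for x
  proof -
    have "q x \<in> q ` carrier P" using that by simp
    then have "inv_into (carrier P) q (q x) \<in> carrier P"
      and "q (inv_into (carrier P) q (q x)) = q x"
      by (simp_all add: inv_into_into f_inv_into_f)
    then show ?thesis
      using that right_hom_closed[OF q] by (auto simp: h_def intro: eq)
  qed
  have "h \<in> mod_hom R Z Y"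
    unfolding h_def
  proof (rule mod_hom_eqI[OF assms(2)])
    let ?h = "\<lambda>z. g (inv_into (carrier P) q z)"
    have h': "?h (q x) = g x" if "x \<in> carrier P" for x
      using h[OF that] that right_hom_closed[OF q] by (simp add: h_def)
    show "?h x \<in> carrier Y" if "x \<in> carrier Z" for x
      using that unfolding assms(5)[symmetric] by (auto simp: h' right_hom_closed[OF g])
    show "?h (x \<oplus>\<^bsub>Z\<^esub> y) = ?h x \<oplus>\<^bsub>Y\<^esub> ?h y" if "x \<in> carrier Z" "y \<in> carrier Z" for x y
      using that unfolding assms(5)[symmetric]
      by (auto simp: h' right_hom_add[OF g] right_hom_add[OF q, symmetric])
    show "?h (r \<odot>\<^bsub>Z\<^esub> x) = r \<odot>\<^bsub>Y\<^esub> ?h x" if "r \<in> carrier R" "x \<in> carrier Z" for r x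
      using that unfolding assms(5)[symmetric]
      by (auto simp: h' right_hom_act[OF g] right_hom_act[OF q, symmetric] P.act_closed)
  qed
  with h show thesis by (intro that[of h]) auto
qed

text \<open>Both quotients and transport along an injection are instances.\<close>

lemma image_module:
  fixes M :: "('a, 'm) module" and q :: "'m \<Rightarrow> 'n"
  assumes "right_module R M"
    and add: "\<And>x x' y y'. \<lbrakk>x \<in> carrier M; x' \<in> carrier M; y \<in> carrier M; y' \<in> carrier M;
      q x = q x'; q y = q y'\<rbrakk> \<Longrightarrow> q (x \<oplus>\<^bsub>M\<^esub> y) = q (x' \<oplus>\<^bsub>M\<^esub> y')"
    and act: "\<And>r x x'. \<lbrakk>r \<in> carrier R; x \<in> carrier M; x' \<in> carrier M; q x = q x'\<rbrakk>
      \<Longrightarrow> q (r \<odot>\<^bsub>M\<^esub> x) = q (r \<odot>\<^bsub>M\<^esub> x')"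
  obtains N :: "('a, 'n) module" where "right_module R N" and "right_hom R M N q"
    and "q ` carrier M = carrier N"
proof -
  interpret M: right_module R M by fact
  \<comment> \<open>The operations on the image are computed on chosen preimages; the congruence
    hypotheses \<open>add\<close> and \<open>act\<close> make the choice irrelevant.\<close>
  define rep where "rep = inv_into (carrier M) q"
  have rep: "rep (q x) \<in> carrier M" "q (rep (q x)) = q x" if "x \<in> carrier M" for x
    using that by (auto simp: rep_def inv_into_into f_inv_into_f)
  define N :: "('a, 'n) module" where
    "N = \<lparr>carrier = q ` carrier M, monoid.mult = undefined, one = undefined,
      zero = q \<zero>\<^bsub>M\<^esub>, add = (\<lambda>u v. q (rep u \<oplus>\<^bsub>M\<^esub> rep v)),
      smult = (\<lambda>r u. q (r \<odot>\<^bsub>M\<^esub> rep u))\<rparr>"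
  have carr: "carrier N = q ` carrier M" and zero: "\<zero>\<^bsub>N\<^esub> = q \<zero>\<^bsub>M\<^esub>" by (simp_all add: N_def)
  have qadd: "q x \<oplus>\<^bsub>N\<^esub> q y = q (x \<oplus>\<^bsub>M\<^esub> y)" if "x \<in> carrier M" "y \<in> carrier M" for x y
    using that by (auto simp: N_def rep intro!: add)
  have qact: "r \<odot>\<^bsub>N\<^esub> q x = q (r \<odot>\<^bsub>M\<^esub> x)" if "r \<in> carrier R" "x \<in> carrier M" for r x
    using that by (auto simp: N_def rep intro!: act)
  have "abelian_group N"
  proof (rule abelian_groupI)
    fix x assume "x \<in> carrier N"
    then obtain m where "m \<in> carrier M" "x = q m" by (auto simp: carr)
    then show "\<exists>y\<in>carrier N. y \<oplus>\<^bsub>N\<^esub> x = \<zero>\<^bsub>N\<^esub>"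
      by (intro bexI[of _ "q (\<ominus>\<^bsub>M\<^esub> m)"]) (auto simp: carr qadd zero M.M.l_neg)
  qed (auto simp: carr qadd zero M.M.a_ac)
  then have "right_module R N"
    by (intro right_module.intro right_module_axioms.intro M.R.ring_axioms)
      (auto simp: carr qadd qact M.act_closed M.act_add_ring M.act_add_module M.act_mult M.act_one)
  moreover have "right_hom R M N q"
    by (intro right_homI) (auto simp: carr qadd qact)
  ultimately show thesis by (intro that[of N]) (auto simp: carr)
qed

text \<open>The usual quotient consists of cosets, which have type \<open>'m set\<close> and so
  leave the type of the given modules. Selecting one element of every coset keeps the quotient
  inside \<open>'m\<close>.\<close>

lemma cokernel_exists:
  fixes X P :: "('a, 'm) module"
  assumes "right_module R X" "right_module R P" and "i \<in> mod_hom R X P"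
  obtains Z :: "('a, 'm) module" and q where "right_module R Z" "q \<in> mod_hom R P Z"
    and "q ` carrier P = carrier Z"
    and "\<And>x. x \<in> carrier P \<Longrightarrow> q x = \<zero>\<^bsub>Z\<^esub> \<longleftrightarrow> x \<in> i ` carrier X"
proof -
  interpret X: right_module R X by fact
  interpret P: right_module R P by fact
  note i = mod_hom_right_hom[OF assms(3)]
  note i_zero = right_hom_zero[OF X.M.abelian_group_axioms P.M.abelian_group_axioms i]
  note i_minus = right_hom_minus[OF X.M.abelian_group_axioms P.M.abelian_group_axioms i]
  define E where "E x y \<longleftrightarrow> y \<in> carrier P \<and> (\<exists>t\<in>carrier X. x = y \<oplus>\<^bsub>P\<^esub> i t)" for x y
  define q where "q x = (SOME y. E x y)" for x
  have refl: "E x x" if "x \<in> carrier P" for x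
    using that i_zero by (auto simp: E_def intro!: bexI[of _ "\<zero>\<^bsub>X\<^esub>"])
  have sym: "E y x" if "x \<in> carrier P" "E x y" for x y
  proof -
    from that obtain t where t: "t \<in> carrier X" "x = y \<oplus>\<^bsub>P\<^esub> i t" and y: "y \<in> carrier P"
      by (auto simp: E_def)
    \<comment> \<open>The negative of \<open>t\<close> is written as a difference from zero, so that
      \<open>i_minus\<close> applies.\<close>
    have "y = x \<oplus>\<^bsub>P\<^esub> i (\<zero>\<^bsub>X\<^esub> \<ominus>\<^bsub>X\<^esub> t)"
      using t y right_hom_closed[OF i]
      by (simp add: i_minus i_zero P.M.minus_eq P.M.a_assoc P.M.r_neg)
    then show ?thesis using t that by (auto simp: E_def)
  qed
  have trans: "E x z" if "E x y" "E y z" for x y z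
    using that right_hom_closed[OF i]
    by (auto simp: E_def P.M.a_assoc right_hom_add[OF i, symmetric])
  have q_eq: "q x = q y \<longleftrightarrow> E x y" if "x \<in> carrier P" "y \<in> carrier P" for x y
  proof
    assume "E x y"
    \<comment> \<open>For equivalent elements the predicates \<open>E x\<close> and
      \<open>E y\<close> are equal, so \<open>SOME\<close> picks literally the same representative
      for both.\<close>
    then have "E x = E y" using sym trans that by blast
    then show "q x = q y" by (simp add: q_def)
  next
    assume eq: "q x = q y"
    have "E x (q x)" "E y (q y)" unfolding q_def by (metis someI refl that)+
    then show "E x y" using eq trans sym that by metis
  qed
  obtain Z :: "('a, 'm) module" where Z: "right_module R Z" "right_hom R P Z q"
    and im: "q ` carrier P = carrier Z"
  proof (rule image_module[OF assms(2)])
    fix x x' y y' assume c: "x \<in> carrier P" "x' \<in> carrier P" "y \<in> carrier P" "y' \<in> carrier P"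
      and "q x = q x'" "q y = q y'"
    then have "E x x'" "E y y'" by (auto simp: q_eq)
    then obtain s t where s: "s \<in> carrier X" "x = x' \<oplus>\<^bsub>P\<^esub> i s"
      and t: "t \<in> carrier X" "y = y' \<oplus>\<^bsub>P\<^esub> i t"
      by (auto simp: E_def)
    then have "x \<oplus>\<^bsub>P\<^esub> y = (x' \<oplus>\<^bsub>P\<^esub> y') \<oplus>\<^bsub>P\<^esub> i (s \<oplus>\<^bsub>X\<^esub> t)"
      using c right_hom_closed[OF i] by (simp add: right_hom_add[OF i] P.M.a_ac)
    then have "E (x \<oplus>\<^bsub>P\<^esub> y) (x' \<oplus>\<^bsub>P\<^esub> y')" using s t c by (auto simp: E_def)
    then show "q (x \<oplus>\<^bsub>P\<^esub> y) = q (x' \<oplus>\<^bsub>P\<^esub> y')" using c by (subst q_eq) auto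
  next
    fix r x x' assume c: "r \<in> carrier R" "x \<in> carrier P" "x' \<in> carrier P" and "q x = q x'"
    then obtain s where s: "s \<in> carrier X" "x = x' \<oplus>\<^bsub>P\<^esub> i s" by (auto simp: q_eq E_def)
    then have "r \<odot>\<^bsub>P\<^esub> x = r \<odot>\<^bsub>P\<^esub> x' \<oplus>\<^bsub>P\<^esub> i (r \<odot>\<^bsub>X\<^esub> s)"
      using c right_hom_closed[OF i] by (simp add: P.act_add_module right_hom_act[OF i])
    then have "E (r \<odot>\<^bsub>P\<^esub> x) (r \<odot>\<^bsub>P\<^esub> x')" using s c by (auto simp: E_def P.act_closed X.act_closed)
    then show "q (r \<odot>\<^bsub>P\<^esub> x) = q (r \<odot>\<^bsub>P\<^esub> x')" using c by (subst q_eq) (auto simp: P.act_closed)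
  qed
  have zero: "q \<zero>\<^bsub>P\<^esub> = \<zero>\<^bsub>Z\<^esub>"
    using right_hom_zero[OF P.M.abelian_group_axioms _ Z(2)]
      right_module_abelian_group[OF Z(1)] by simp
  show thesis
  proof (rule that[OF Z(1) right_hom_restrict[OF assms(2) Z(2)]])
    show "restrict q (carrier P) ` carrier P = carrier Z" using im by simp
    fix x assume x: "x \<in> carrier P"
    then have "q x = \<zero>\<^bsub>Z\<^esub> \<longleftrightarrow> E x \<zero>\<^bsub>P\<^esub>" by (simp add: zero[symmetric] q_eq)
    also have "\<dots> \<longleftrightarrow> x \<in> i ` carrier X"
      using right_hom_closed[OF i] by (auto simp: E_def)
    finally show "restrict q (carrier P) x = \<zero>\<^bsub>Z\<^esub> \<longleftrightarrow> x \<in> i ` carrier X" using x by simp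
  qed
qed


section \<open>Free modules and left projective approximations\<close>

text \<open>Vectors are extensional on \<open>I\<close>, so they are equal as soon as their
  coordinates are, and there are finitely many when \<open>I\<close> and the ring are finite.
  Scalars multiply the coordinates from the right, as a right module demands.\<close>

definition free_module :: "'a ring \<Rightarrow> 'i set \<Rightarrow> ('a, 'i \<Rightarrow> 'a) module"
  where "free_module R I =
    \<lparr>carrier = I \<rightarrow>\<^sub>E carrier R, monoid.mult = undefined, one = undefined,
     zero = (\<lambda>i\<in>I. \<zero>\<^bsub>R\<^esub>), add = (\<lambda>x y. \<lambda>i\<in>I. x i \<oplus>\<^bsub>R\<^esub> y i),
     smult = (\<lambda>r x. \<lambda>i\<in>I. x i \<otimes>\<^bsub>R\<^esub> r)\<rparr>"

lemma free_module_simps: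
  "carrier (free_module R I) = I \<rightarrow>\<^sub>E carrier R"
  "\<zero>\<^bsub>free_module R I\<^esub> = (\<lambda>i\<in>I. \<zero>\<^bsub>R\<^esub>)"
  "x \<oplus>\<^bsub>free_module R I\<^esub> y = (\<lambda>i\<in>I. x i \<oplus>\<^bsub>R\<^esub> y i)"
  "r \<odot>\<^bsub>free_module R I\<^esub> x = (\<lambda>i\<in>I. x i \<otimes>\<^bsub>R\<^esub> r)"
  by (simp_all add: free_module_def)

lemma right_module_free_module:
  assumes "ring R"
  shows "right_module R (free_module R I)"
proof -
  interpret R: ring R by fact
  have mem: "x i \<in> carrier R" if "x \<in> I \<rightarrow>\<^sub>E carrier R" "i \<in> I" for x i
    using that by auto
  have id: "(\<lambda>i\<in>I. x i) = x" if "x \<in> I \<rightarrow>\<^sub>E carrier R" for x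
    using that by (rule PiE_restrict)
  have "abelian_group (free_module R I)"
  proof (rule abelian_groupI, goal_cases)
    case (6 x)
    then show ?case
      by (intro bexI[of _ "\<lambda>i\<in>I. \<ominus>\<^bsub>R\<^esub> x i"])
        (auto simp: free_module_simps mem R.l_neg intro!: restrict_ext)
  qed (simp_all add: free_module_simps mem R.a_ac id PiE_iff cong: restrict_cong)
  then show ?thesis
    by (intro right_module.intro right_module_axioms.intro assms)
      (simp_all add: free_module_simps mem R.l_distr R.r_distr R.m_assoc id PiE_iff
        cong: restrict_cong)
qed

text \<open>Universal property of the free module: this is the map sending the basis vector at
  \<open>i\<close> to \<open>m i\<close>. Compatibility with the action rests on
  \<open>act_mult\<close>, by which acting with \<open>x i\<close> and then with \<open>r\<close> is
  acting with their product.\<close>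

lemma linear_combination_hom:
  assumes "right_module R N" and "finite I" and "m \<in> I \<rightarrow> carrier N"
  shows "right_hom R (free_module R I) N (\<lambda>x. \<Oplus>\<^bsub>N\<^esub>i\<in>I. x i \<odot>\<^bsub>N\<^esub> m i)"
proof -
  interpret N: right_module R N by fact
  have m: "m i \<in> carrier N" if "i \<in> I" for i using that assms(3) by auto
  have mem: "x i \<in> carrier R" if "x \<in> I \<rightarrow>\<^sub>E carrier R" "i \<in> I" for x i
    using that by auto
  have "(\<Oplus>\<^bsub>N\<^esub>i\<in>I. (x i \<otimes>\<^bsub>R\<^esub> r) \<odot>\<^bsub>N\<^esub> m i) = r \<odot>\<^bsub>N\<^esub> (\<Oplus>\<^bsub>N\<^esub>i\<in>I. x i \<odot>\<^bsub>N\<^esub> m i)"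
    if "r \<in> carrier R" "x \<in> I \<rightarrow>\<^sub>E carrier R" for r x
  proof -
    \<comment> \<open>The induction runs over subsets \<open>J\<close> of \<open>I\<close> because
      \<open>x\<close> has to remain a vector indexed by all of \<open>I\<close>.\<close>
    have "(\<Oplus>\<^bsub>N\<^esub>i\<in>J. (x i \<otimes>\<^bsub>R\<^esub> r) \<odot>\<^bsub>N\<^esub> m i) = r \<odot>\<^bsub>N\<^esub> (\<Oplus>\<^bsub>N\<^esub>i\<in>J. x i \<odot>\<^bsub>N\<^esub> m i)"
      if "J \<subseteq> I" for J
      using finite_subset[OF that assms(2)] that
    proof (induction J)
      case empty
      then show ?case using \<open>r \<in> _\<close> by (simp add: N.act_zero)
    next
      case (insert j J)
      then have "i \<in> I" if "i \<in> insert j J" for i using that by auto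
      with insert \<open>r \<in> _\<close> \<open>x \<in> _\<close> show ?case
        by (simp add: Pi_iff m mem N.act_closed N.act_mult N.act_add_module)
    qed
    then show ?thesis by simp
  qed
  moreover have "(\<Oplus>\<^bsub>N\<^esub>i\<in>I. (x i \<oplus>\<^bsub>R\<^esub> y i) \<odot>\<^bsub>N\<^esub> m i)
      = (\<Oplus>\<^bsub>N\<^esub>i\<in>I. x i \<odot>\<^bsub>N\<^esub> m i) \<oplus>\<^bsub>N\<^esub> (\<Oplus>\<^bsub>N\<^esub>i\<in>I. y i \<odot>\<^bsub>N\<^esub> m i)"
    if "x \<in> I \<rightarrow>\<^sub>E carrier R" "y \<in> I \<rightarrow>\<^sub>E carrier R" for x y
  proof -
    have "(\<Oplus>\<^bsub>N\<^esub>i\<in>I. (x i \<oplus>\<^bsub>R\<^esub> y i) \<odot>\<^bsub>N\<^esub> m i)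
        = (\<Oplus>\<^bsub>N\<^esub>i\<in>I. x i \<odot>\<^bsub>N\<^esub> m i \<oplus>\<^bsub>N\<^esub> y i \<odot>\<^bsub>N\<^esub> m i)"
      using that by (intro N.M.finsum_cong')
        (auto simp: m mem[OF that(1)] mem[OF that(2)] N.act_closed N.act_add_ring)
    also have "\<dots> = (\<Oplus>\<^bsub>N\<^esub>i\<in>I. x i \<odot>\<^bsub>N\<^esub> m i) \<oplus>\<^bsub>N\<^esub> (\<Oplus>\<^bsub>N\<^esub>i\<in>I. y i \<odot>\<^bsub>N\<^esub> m i)"
      by (rule N.M.finsum_addf)
        (auto simp: m mem[OF that(1)] mem[OF that(2)] N.act_closed)
    finally show ?thesis .
  qed
  moreover have "(\<Oplus>\<^bsub>N\<^esub>i\<in>I. x i \<odot>\<^bsub>N\<^esub> m i) \<in> carrier N" if "x \<in> I \<rightarrow>\<^sub>E carrier R" for x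
    by (rule N.M.finsum_closed) (auto simp: m mem[OF that] N.act_closed)
  moreover have restr: "(\<Oplus>\<^bsub>N\<^esub>i\<in>I. (\<lambda>i\<in>I. x i) i \<odot>\<^bsub>N\<^esub> m i) = (\<Oplus>\<^bsub>N\<^esub>i\<in>I. x i \<odot>\<^bsub>N\<^esub> m i)"
    if "x \<in> I \<rightarrow> carrier R" for x
    using that by (intro N.M.finsum_cong') (auto simp: m N.act_closed Pi_iff)
  ultimately show ?thesis
    by (intro right_homI) (simp_all add: free_module_simps restr Pi_iff mem)
qed

definition unit_vector :: "'a ring \<Rightarrow> 'i set \<Rightarrow> 'i \<Rightarrow> 'i \<Rightarrow> 'a"
  where "unit_vector R I j = (\<lambda>i\<in>I. if i = j then \<one>\<^bsub>R\<^esub> else \<zero>\<^bsub>R\<^esub>)"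

lemma unit_vector_closed:
  assumes "ring R"
  shows "unit_vector R I j \<in> carrier (free_module R I)"
proof -
  interpret R: ring R by fact
  show ?thesis by (auto simp: unit_vector_def free_module_simps)
qed

lemma free_module_expansion:
  assumes "ring R" and "finite I" and "x \<in> carrier (free_module R I)"
  shows "x = (\<Oplus>\<^bsub>free_module R I\<^esub>i\<in>I. x i \<odot>\<^bsub>free_module R I\<^esub> unit_vector R I i)"
    (is "x = ?y")
proof -
  interpret R: ring R by fact
  interpret F: right_module R "free_module R I" by (rule right_module_free_module) fact
  have x: "x i \<in> carrier R" if "i \<in> I" for i
    using assms(3) that by (auto simp: free_module_simps)
  have terms: "(\<lambda>i. x i \<odot>\<^bsub>free_module R I\<^esub> unit_vector R I i) \<in> I \<rightarrow> carrier (free_module R I)"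
    using x by (auto intro!: F.act_closed unit_vector_closed[OF assms(1)])
  \<comment> \<open>Taking a coordinate commutes with finite sums. The summation set
    \<open>J\<close> is kept apart from \<open>I\<close>, since an induction on \<open>I\<close>
    would change the module as well.\<close>
  have coord: "(\<Oplus>\<^bsub>free_module R I\<^esub>i\<in>J. v i) j = (\<Oplus>\<^bsub>R\<^esub>i\<in>J. v i j)"
    if "finite J" "v \<in> J \<rightarrow> carrier (free_module R I)" "j \<in> I" for J v j
    using that(1,2)
  proof (induction J)
    case empty
    then show ?case using that(3) by (simp add: free_module_simps)
  next
    case (insert i J)
    then have "v k j \<in> carrier R" if "k \<in> insert i J" for k
      using that \<open>j \<in> I\<close> by (auto simp: free_module_simps Pi_iff)
    with insert \<open>j \<in> I\<close> show ?case
      by (simp add: Pi_iff) (simp add: free_module_simps)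
  qed
  have "?y j = x j" if j: "j \<in> I" for j
  proof -
    have "?y j = (\<Oplus>\<^bsub>R\<^esub>i\<in>I. (x i \<odot>\<^bsub>free_module R I\<^esub> unit_vector R I i) j)"
      by (rule coord[OF assms(2) terms j])
    also have "\<dots> = (\<Oplus>\<^bsub>R\<^esub>i\<in>I. if j = i then x i else \<zero>\<^bsub>R\<^esub>)"
      using j x by (intro R.finsum_cong') (auto simp: free_module_simps unit_vector_def)
    also have "\<dots> = x j"
      using R.finsum_singleton[OF j assms(2), of x] x by auto
    finally show ?thesis .
  qed
  moreover have "?y \<in> carrier (free_module R I)" by (rule F.M.finsum_closed[OF terms])
  ultimately show ?thesis
    using assms(3) unfolding free_module_simps by (intro PiE_ext) auto
qed

section \<open>Finite modules and their copies inside an infinite type\<close>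

lemma ex_inj_on_infinite:
  assumes "finite A" and "infinite (UNIV :: 'm set)"
  obtains q :: "'b \<Rightarrow> 'm" where "inj_on q A"
proof -
  obtain B :: "'m set" where "finite B" "card B = card A"
    using infinite_arbitrarily_large[OF assms(2)] by metis
  then obtain q where "bij_betw q A B"
    using assms(1) finite_same_card_bij by metis
  then show thesis by (intro that[of q]) (auto simp: bij_betw_def)
qed

text \<open>The whole carrier generates: \<open>x\<close> is the combination with coefficient one at
  \<open>x\<close> and zero elsewhere.\<close>

lemma finite_fin_gen_module:
  assumes "finite (carrier M)" and "right_module R M"
  shows "fin_gen_module R M"
proof -
  interpret M: right_module R M by fact
  show ?thesis
    unfolding fin_gen_module_def
  proof (intro exI[of _ "carrier M"] conjI ballI)
    fix x assume x: "x \<in> carrier M"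
    let ?c = "\<lambda>b. if x = b then \<one>\<^bsub>R\<^esub> else \<zero>\<^bsub>R\<^esub>"
    have "(\<Oplus>\<^bsub>M\<^esub>b\<in>carrier M. ?c b \<odot>\<^bsub>M\<^esub> b) = (\<Oplus>\<^bsub>M\<^esub>b\<in>carrier M. if x = b then b else \<zero>\<^bsub>M\<^esub>)"
      by (intro M.M.finsum_cong') (auto simp: M.zero_act M.act_one)
    also have "\<dots> = x" by (rule M.M.finsum_singleton[OF x assms(1)]) auto
    finally show "\<exists>c. c \<in> carrier M \<rightarrow> carrier R \<and> x = (\<Oplus>\<^bsub>M\<^esub>b\<in>carrier M. c b \<odot>\<^bsub>M\<^esub> b)"
      by (intro exI[of _ ?c]) auto
  qed (use assms in auto)
qed

lemma right_hom_inv_into: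
  assumes "right_module R M" "right_hom R M N f" "bij_betw f (carrier M) (carrier N)"
  shows "right_hom R N M (inv_into (carrier M) f)"
proof -
  interpret M: right_module R M by fact
  let ?g = "inv_into (carrier M) f"
  have g: "?g (f x) = x" if "x \<in> carrier M" for x
    using assms(3) that by (simp add: bij_betw_def)
  have im: "carrier N = f ` carrier M" using assms(3) by (simp add: bij_betw_def)
  show ?thesis
    by (intro right_homI)
      (auto simp: im g right_hom_add[OF assms(2), symmetric] right_hom_act[OF assms(2), symmetric]
        M.act_closed)
qed

text \<open>The ring does not determine the type \<open>'m\<close> of module elements; the parameter
  of type \<open>'m itself\<close> fixes it.\<close>

locale finite_ring_stable =
  fixes R :: "'a ring" and carrier_type :: "'m itself"
  assumes ring_R: "ring R" and finite_R: "finite (carrier R)"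
    and infinite_type: "infinite (UNIV :: 'm set)"
begin

text \<open>Every element is a combination of the finitely many generators with coefficients from a
  finite ring. Restricting the coefficient functions to \<open>B\<close> leaves only finitely many
  of them.\<close>

lemma fg_module_iff: "(M :: ('a, 'm) module) \<in> fg_modules R \<longleftrightarrow> right_module R M \<and> finite (carrier M)"
proof
  assume "M \<in> fg_modules R"
  then obtain B where M: "right_module R M" and B: "finite B" "B \<subseteq> carrier M"
    and gen: "\<And>x. x \<in> carrier M \<Longrightarrow> \<exists>c. c \<in> B \<rightarrow> carrier R \<and> x = (\<Oplus>\<^bsub>M\<^esub>b\<in>B. c b \<odot>\<^bsub>M\<^esub> b)"
    by (auto simp: fg_modules_def fin_gen_module_def)
  interpret M: right_module R M by fact
  have "carrier M \<subseteq> (\<lambda>c. \<Oplus>\<^bsub>M\<^esub>b\<in>B. c b \<odot>\<^bsub>M\<^esub> b) ` (B \<rightarrow>\<^sub>E carrier R)"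
  proof
    fix x assume "x \<in> carrier M"
    then obtain c where c: "c \<in> B \<rightarrow> carrier R" "x = (\<Oplus>\<^bsub>M\<^esub>b\<in>B. c b \<odot>\<^bsub>M\<^esub> b)"
      using gen by blast
    have "x = (\<Oplus>\<^bsub>M\<^esub>b\<in>B. restrict c B b \<odot>\<^bsub>M\<^esub> b)"
      unfolding c(2) by (rule M.M.finsum_cong') (use B c in \<open>auto intro!: M.act_closed\<close>)
    then show "x \<in> (\<lambda>c. \<Oplus>\<^bsub>M\<^esub>b\<in>B. c b \<odot>\<^bsub>M\<^esub> b) ` (B \<rightarrow>\<^sub>E carrier R)"
      using c(1) by (intro image_eqI) (auto simp: restrict_PiE_iff)
  qed
  then have "finite (carrier M)"
    by (rule finite_subset) (use B finite_R in \<open>auto intro: finite_PiE\<close>)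
  with M show "right_module R M \<and> finite (carrier M)" by simp
qed (auto simp: fg_modules_def finite_fin_gen_module)

text \<open>A finite set of vectors embeds into the infinite type \<open>'m\<close>, and the module
  structure is transported along the embedding \<open>d\<close>; the inverse \<open>c\<close> reads
  off coordinates. The copy is projective because a map out of it is determined by its values on the
  basis, and these can be lifted one by one.\<close>

lemma free_module_copy:
  assumes "finite (I :: 'i set)"
  obtains P :: "('a, 'm) module" and c d where "P \<in> fg_modules R" "projective_module R P"
    and "right_hom R P (free_module R I) c" "right_hom R (free_module R I) P d"
    and "\<And>x. x \<in> carrier P \<Longrightarrow> d (c x) = x"
    and "\<And>y. y \<in> carrier (free_module R I) \<Longrightarrow> c (d y) = y"
proof -
  let ?F = "free_module R I"
  have F: "right_module R ?F" by (rule right_module_free_module[OF ring_R])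
  interpret F: right_module R ?F by fact
  have fin: "finite (carrier ?F)"
    using assms finite_R by (auto simp: free_module_simps intro: finite_PiE)
  obtain d :: "('i \<Rightarrow> 'a) \<Rightarrow> 'm" where inj: "inj_on d (carrier ?F)"
    using ex_inj_on_infinite[OF fin infinite_type] by blast
  obtain P :: "('a, 'm) module" where P: "right_module R P" "right_hom R ?F P d"
    and im: "d ` carrier ?F = carrier P"
  proof (rule image_module[OF F, of d])
    fix x x' y y'
    assume "x \<in> carrier ?F" "x' \<in> carrier ?F" "y \<in> carrier ?F" "y' \<in> carrier ?F"
      "d x = d x'" "d y = d y'"
    then show "d (x \<oplus>\<^bsub>?F\<^esub> y) = d (x' \<oplus>\<^bsub>?F\<^esub> y')" by (metis inj inj_onD)
  next
    fix r x x' assume "r \<in> carrier R" "x \<in> carrier ?F" "x' \<in> carrier ?F" "d x = d x'"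
    then show "d (r \<odot>\<^bsub>?F\<^esub> x) = d (r \<odot>\<^bsub>?F\<^esub> x')" by (metis inj inj_onD)
  qed
  define c where "c = inv_into (carrier ?F) d"
  have bij: "bij_betw d (carrier ?F) (carrier P)" using inj im by (simp add: bij_betw_def)
  have c: "right_hom R P ?F c"
    unfolding c_def by (rule right_hom_inv_into[OF F P(2) bij])
  have dc: "d (c x) = x" if "x \<in> carrier P" for x
    using that im by (simp add: c_def f_inv_into_f)
  have cd: "c (d y) = y" if "y \<in> carrier ?F" for y
    using that inj by (simp add: c_def)
  interpret P: right_module R P by fact
  define b where "b i = d (unit_vector R I i)" for i
  have b: "b i \<in> carrier P" for i
    unfolding b_def by (intro right_hom_closed[OF P(2)] unit_vector_closed[OF ring_R])
  have coeff: "c x i \<in> carrier R" if "x \<in> carrier P" "i \<in> I" for x i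
    using right_hom_closed[OF c that(1)] that(2) by (auto simp: free_module_simps)
  have expansion: "x = (\<Oplus>\<^bsub>P\<^esub>i\<in>I. c x i \<odot>\<^bsub>P\<^esub> b i)" if x: "x \<in> carrier P" for x
  proof -
    have cx: "c x \<in> carrier ?F" by (rule right_hom_closed[OF c x])
    have "x = d (\<Oplus>\<^bsub>?F\<^esub>i\<in>I. c x i \<odot>\<^bsub>?F\<^esub> unit_vector R I i)"
      using free_module_expansion[OF ring_R assms cx] dc[OF x] by simp
    also have "\<dots> = (\<Oplus>\<^bsub>P\<^esub>i\<in>I. d (c x i \<odot>\<^bsub>?F\<^esub> unit_vector R I i))"
      by (rule right_hom_finsum[OF F.M.abelian_group_axioms P.M.abelian_group_axioms P(2) assms])
        (use coeff[OF x] in \<open>auto intro!: F.act_closed unit_vector_closed[OF ring_R]\<close>)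
    also have "\<dots> = (\<Oplus>\<^bsub>P\<^esub>i\<in>I. c x i \<odot>\<^bsub>P\<^esub> b i)"
      by (rule P.M.finsum_cong') (use coeff[OF x] b in
        \<open>auto simp: b_def[symmetric] right_hom_act[OF P(2)] unit_vector_closed[OF ring_R]
          intro!: P.act_closed\<close>)
    finally show ?thesis .
  qed
  have "projective_module R P"
    unfolding projective_module_def
  proof (intro conjI allI ballI impI P(1))
    fix M N :: "('a, 'm) module" and g f
    assume g: "g \<in> mod_hom R M N" and f: "f \<in> mod_hom R P N"
      and M: "right_module R M" and N: "right_module R N" and surj: "g ` carrier M = carrier N"
    interpret M: right_module R M by fact
    interpret N: right_module R N by fact
    \<comment> \<open>No condition on \<open>i\<close> is needed: for an index outside
      \<open>I\<close> the unit vector is the zero vector, so \<open>b i\<close> still lies in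
      \<open>P\<close>.\<close>
    have "\<exists>m. m \<in> carrier M \<and> g m = f (b i)" for i
      using mod_hom_closed[OF f b] surj by (metis imageE)
    then obtain m where m: "m i \<in> carrier M" "g (m i) = f (b i)" for i by metis
    let ?L = "\<lambda>y. \<Oplus>\<^bsub>M\<^esub>i\<in>I. y i \<odot>\<^bsub>M\<^esub> m i"
    have L: "right_hom R ?F M ?L" by (rule linear_combination_hom[OF M assms]) (use m in auto)
    show "\<exists>h\<in>mod_hom R P M. \<forall>x\<in>carrier P. g (h x) = f x"
    proof (intro bexI[of _ "\<lambda>x\<in>carrier P. ?L (c x)"] ballI)
      show "(\<lambda>x\<in>carrier P. ?L (c x)) \<in> mod_hom R P M"
        using right_hom_closed[OF c]
        by (intro mod_hom_eqI[OF P(1)])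
          (simp_all add: right_hom_add[OF c] right_hom_act[OF c]
            right_hom_closed[OF L] right_hom_add[OF L] right_hom_act[OF L])
      fix x assume x: "x \<in> carrier P"
      have "g (?L (c x)) = (\<Oplus>\<^bsub>N\<^esub>i\<in>I. g (c x i \<odot>\<^bsub>M\<^esub> m i))"
        by (rule right_hom_finsum[OF M.M.abelian_group_axioms N.M.abelian_group_axioms
              mod_hom_right_hom[OF g] assms])
          (use coeff[OF x] m in \<open>auto intro!: M.act_closed\<close>)
      also have "\<dots> = (\<Oplus>\<^bsub>N\<^esub>i\<in>I. f (c x i \<odot>\<^bsub>P\<^esub> b i))"
        by (rule N.M.finsum_cong') (use coeff[OF x] m b mod_hom_closed[OF f] in
          \<open>auto simp: mod_hom_act[OF g] mod_hom_act[OF f] intro!: N.act_closed\<close>)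
      also have "\<dots> = f (\<Oplus>\<^bsub>P\<^esub>i\<in>I. c x i \<odot>\<^bsub>P\<^esub> b i)"
        by (rule right_hom_finsum[OF P.M.abelian_group_axioms N.M.abelian_group_axioms
              mod_hom_right_hom[OF f] assms, symmetric])
          (use coeff[OF x] b in \<open>auto intro!: P.act_closed\<close>)
      finally show "g ((\<lambda>x\<in>carrier P. ?L (c x)) x) = f x"
        using x expansion[OF x] by simp
    qed
  qed
  moreover have "P \<in> fg_modules R"
    using P(1) im fin by (auto simp: fg_module_iff dest: sym)
  ultimately show thesis by (intro that[OF _ _ c P(2) dc cd])
qed

text \<open>The free module on all elements of \<open>Q\<close> maps onto \<open>Q\<close>, and
  lifting the identity of \<open>Q\<close> splits this surjection. The lifting takes place on the
  copy of the free module inside \<open>'m\<close> and is then carried back by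
  \<open>c\<close>.\<close>

lemma projective_retract_of_free:
  assumes "(Q :: ('a, 'm) module) \<in> fg_modules R" and "projective_module R Q"
  obtains s t where "right_hom R Q (free_module R (carrier Q)) s"
    and "right_hom R (free_module R (carrier Q)) Q t" and "\<And>x. x \<in> carrier Q \<Longrightarrow> t (s x) = x"
proof -
  let ?F = "free_module R (carrier Q)"
  have Q: "right_module R Q" and fin: "finite (carrier Q)"
    using assms(1) by (auto simp: fg_module_iff)
  interpret Q: right_module R Q by fact
  obtain P :: "('a, 'm) module" and c d where P: "P \<in> fg_modules R"
    and c: "right_hom R P ?F c" and d: "right_hom R ?F P d"
    and dc: "\<And>x. x \<in> carrier P \<Longrightarrow> d (c x) = x" and cd: "\<And>y. y \<in> carrier ?F \<Longrightarrow> c (d y) = y"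
    using free_module_copy[OF fin] by metis
  have P': "right_module R P" using P by (simp add: fg_module_iff)
  define t where "t y = (\<Oplus>\<^bsub>Q\<^esub>b\<in>carrier Q. y b \<odot>\<^bsub>Q\<^esub> b)" for y
  have t: "right_hom R ?F Q t"
    unfolding t_def by (rule linear_combination_hom[OF Q fin]) auto
  have t_unit: "t (unit_vector R (carrier Q) x) = x" if x: "x \<in> carrier Q" for x
  proof -
    have "t (unit_vector R (carrier Q) x) = (\<Oplus>\<^bsub>Q\<^esub>b\<in>carrier Q. if x = b then b else \<zero>\<^bsub>Q\<^esub>)"
      unfolding t_def by (rule Q.M.finsum_cong') (auto simp: unit_vector_def Q.zero_act Q.act_one)
    also have "\<dots> = x" by (rule Q.M.finsum_singleton[OF x fin]) auto
    finally show ?thesis .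
  qed
  define g where "g = (\<lambda>x\<in>carrier P. t (c x))"
  have g: "g \<in> mod_hom R P Q"
    unfolding g_def using right_hom_closed[OF c]
    by (intro mod_hom_eqI[OF P'])
      (simp_all add: right_hom_add[OF c] right_hom_act[OF c]
        right_hom_closed[OF t] right_hom_add[OF t] right_hom_act[OF t])
  have "g ` carrier P = carrier Q"
  proof (intro equalityI subsetI)
    fix x assume x: "x \<in> carrier Q"
    let ?u = "unit_vector R (carrier Q) x"
    have "?u \<in> carrier ?F" by (rule unit_vector_closed[OF ring_R])
    then show "x \<in> g ` carrier P"
      by (intro image_eqI[of _ _ "d ?u"])
        (simp_all add: g_def cd t_unit[OF x] right_hom_closed[OF d])
  qed (use mod_hom_closed[OF g] in auto)
  then obtain h where h: "h \<in> mod_hom R Q P"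
    and gh: "\<And>x. x \<in> carrier Q \<Longrightarrow> g (h x) = (\<lambda>x\<in>carrier Q. x) x"
    using projective_lift[OF assms(2) g ident_mod_hom[OF Q] P' Q] by blast
  show thesis
  proof (rule that[of "\<lambda>x. c (h x)" t])
    show "right_hom R Q ?F (\<lambda>x. c (h x))"
      by (intro right_homI) (simp_all add: mod_hom_closed[OF h] mod_hom_add[OF h] mod_hom_act[OF h]
        right_hom_closed[OF c] right_hom_add[OF c] right_hom_act[OF c])
    show "t (c (h x)) = x" if "x \<in> carrier Q" for x
      using gh[OF that] mod_hom_closed[OF h that] that by (simp add: g_def)
  qed (rule t)
qed

text \<open>The approximation is the evaluation map of \<open>X\<close> into the power of \<open>R\<close> indexed by the
  dual of \<open>X\<close>; it need not be injective.\<close>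

lemma left_projective_approximation:
  assumes "(X :: ('a, 'm) module) \<in> fg_modules R"
  obtains P :: "('a, 'm) module" and i where "P \<in> fg_modules R" "projective_module R P"
    and "i \<in> mod_hom R X P"
    and "\<And>(Q :: ('a, 'm) module) f.
      \<lbrakk>Q \<in> fg_modules R; projective_module R Q; f \<in> mod_hom R X Q\<rbrakk>
        \<Longrightarrow> \<exists>g \<in> mod_hom R P Q. \<forall>x\<in>carrier X. f x = g (i x)"
proof -
  have X: "right_module R X" and fin: "finite (carrier X)"
    using assms by (auto simp: fg_module_iff)
  interpret R: ring R by (rule ring_R)
  interpret X: right_module R X by fact
  \<comment> \<open>This is the dual of \<open>X\<close>, the right linear maps from
    \<open>X\<close> to the ring. It is finite because \<open>X\<close> and the ring are.\<close>
  define I where "I = {\<psi> \<in> carrier X \<rightarrow>\<^sub>E carrier R.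
    (\<forall>x\<in>carrier X. \<forall>y\<in>carrier X. \<psi> (x \<oplus>\<^bsub>X\<^esub> y) = \<psi> x \<oplus>\<^bsub>R\<^esub> \<psi> y) \<and>
    (\<forall>r\<in>carrier R. \<forall>x\<in>carrier X. \<psi> (r \<odot>\<^bsub>X\<^esub> x) = \<psi> x \<otimes>\<^bsub>R\<^esub> r)}"
  have "finite I"
    by (rule finite_subset[OF _ finite_PiE[OF fin finite_R]]) (auto simp: I_def)
  let ?F = "free_module R I"
  obtain P :: "('a, 'm) module" and c d where P: "P \<in> fg_modules R" "projective_module R P"
    and c: "right_hom R P ?F c" and d: "right_hom R ?F P d"
    and cd: "\<And>y. y \<in> carrier ?F \<Longrightarrow> c (d y) = y"
    using free_module_copy[OF \<open>finite I\<close>] by metis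
  have P': "right_module R P" using P by (simp add: fg_module_iff)
  define ev where "ev x = (\<lambda>\<psi>\<in>I. \<psi> x)" for x
  have ev: "right_hom R X ?F ev"
    by (intro right_homI) (auto simp: ev_def I_def free_module_simps intro!: restrict_ext)
  define i where "i = (\<lambda>x\<in>carrier X. d (ev x))"
  show thesis
  proof (rule that[OF P])
    show "i \<in> mod_hom R X P"
      unfolding i_def using right_hom_closed[OF ev]
      by (intro mod_hom_eqI[OF X])
        (simp_all add: right_hom_add[OF ev] right_hom_act[OF ev]
          right_hom_closed[OF d] right_hom_add[OF d] right_hom_act[OF d])
    fix Q :: "('a, 'm) module" and f
    assume Q: "Q \<in> fg_modules R" "projective_module R Q" and f: "f \<in> mod_hom R X Q"
    let ?G = "free_module R (carrier Q)"
    obtain s t where s: "right_hom R Q ?G s" and t: "right_hom R ?G Q t"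
      and ts: "\<And>x. x \<in> carrier Q \<Longrightarrow> t (s x) = x"
      using projective_retract_of_free[OF Q] by metis
    \<comment> \<open>Embedding \<open>Q\<close> into a free module by \<open>s\<close> turns
      \<open>f\<close> into a family of coordinate functionals \<open>\<psi> k\<close>, each of
      which is an element of the dual \<open>I\<close>.\<close>
    define \<psi> where "\<psi> k = (\<lambda>x\<in>carrier X. s (f x) k)" for k
    have sf: "s (f x) \<in> carrier Q \<rightarrow>\<^sub>E carrier R" if "x \<in> carrier X" for x
      using right_hom_closed[OF s mod_hom_closed[OF f that]] by (simp add: free_module_simps)
    have \<psi>: "\<psi> k \<in> I" if "k \<in> carrier Q" for k
      using that sf by (auto simp: I_def \<psi>_def mod_hom_closed[OF f] mod_hom_add[OF f]
        mod_hom_act[OF f] right_hom_add[OF s] right_hom_act[OF s] X.act_closed free_module_simps)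
    \<comment> \<open>Coordinate \<open>k\<close> of \<open>m y\<close> is the coordinate of
      \<open>y\<close> at the functional \<open>\<psi> k\<close>. On an evaluation vector this
      returns \<open>\<psi> k x\<close>, so \<open>m (ev x)\<close> is \<open>s (f x)\<close>, and
      \<open>t\<close> recovers \<open>f x\<close>.\<close>
    define m where "m y = (\<lambda>k\<in>carrier Q. y (\<psi> k))" for y :: "('m \<Rightarrow> 'a) \<Rightarrow> 'a"
    have m: "right_hom R ?F ?G m"
      by (intro right_homI) (auto simp: m_def free_module_simps \<psi> intro!: restrict_ext)
    show "\<exists>g\<in>mod_hom R P Q. \<forall>x\<in>carrier X. f x = g (i x)"
    proof (intro bexI[of _ "\<lambda>y\<in>carrier P. t (m (c y))"] ballI)
      show "(\<lambda>y\<in>carrier P. t (m (c y))) \<in> mod_hom R P Q"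
        using right_hom_closed[OF c] right_hom_closed[OF m]
        by (intro mod_hom_eqI[OF P'])
          (simp_all add: right_hom_add[OF c] right_hom_act[OF c] right_hom_add[OF m]
            right_hom_act[OF m] right_hom_closed[OF t] right_hom_add[OF t] right_hom_act[OF t])
      fix x assume x: "x \<in> carrier X"
      have "m (ev x) = s (f x)"
        using sf[OF x] x by (simp add: m_def ev_def \<psi> cong: restrict_cong)
          (auto simp: \<psi>_def PiE_iff extensional_def)
      then show "f x = (\<lambda>y\<in>carrier P. t (m (c y))) (i x)"
        using x right_hom_closed[OF ev x] mod_hom_closed[OF f x]
        by (simp add: i_def cd ts right_hom_closed[OF d])
    qed
  qed
qed

end


section \<open>The stable category and the Heller operator\<close>

locale syzygies =
  fixes R :: "'a ring" and S :: "('a, 'm) syzygies"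
  assumes syzygy_choice: "syzygy_choice R S"
begin

abbreviation fgm :: "('a, 'm) module set" where "fgm \<equiv> fg_modules R"

lemma right_module_fg: "X \<in> fgm \<Longrightarrow> right_module R X"
  by (simp add: fg_modules_def)

lemma abelian_group_fg: "X \<in> fgm \<Longrightarrow> abelian_group X"
  by (rule right_module_abelian_group[OF right_module_fg])

lemma
  assumes "X \<in> fgm"
  shows syz_fg: "syz S X \<in> fgm" and cov_fg: "cov S X \<in> fgm"
    and projective_cov: "projective_module R (cov S X)"
    and short_exact_syz: "short_exact R (syz S X) (inc S X) (cov S X) (prj S X) X"
  using syzygy_choice assms by (auto simp: syzygy_choice_def)

lemma
  assumes "X \<in> fgm"
  shows inc_hom: "inc S X \<in> mod_hom R (syz S X) (cov S X)"
    and prj_hom: "prj S X \<in> mod_hom R (cov S X) X"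
    and prj_surj: "prj S X ` carrier (cov S X) = carrier X"
    and inc_inj: "inj_on (inc S X) (carrier (syz S X))"
    and prj_inc: "x \<in> carrier (syz S X) \<Longrightarrow> prj S X (inc S X x) = \<zero>\<^bsub>X\<^esub>"
  using short_exact_syz[OF assms] by (auto simp: short_exact_def)

lemma hom_minus:
  assumes "X \<in> fgm" "Y \<in> fgm" and "h \<in> mod_hom R X Y"
    and "x \<in> carrier X" "y \<in> carrier X"
  shows "h (x \<ominus>\<^bsub>X\<^esub> y) = h x \<ominus>\<^bsub>Y\<^esub> h y"
  using right_hom_minus[OF abelian_group_fg abelian_group_fg mod_hom_right_hom] assms .

lemma hom_zero:
  assumes "X \<in> fgm" "Y \<in> fgm" and "h \<in> mod_hom R X Y"
  shows "h \<zero>\<^bsub>X\<^esub> = \<zero>\<^bsub>Y\<^esub>"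
  using right_hom_zero[OF abelian_group_fg abelian_group_fg mod_hom_right_hom] assms .

section \<open>The stable relation and the stable category\<close>

lemma stable_relI:
  assumes "X \<in> fgm" "P \<in> fgm" "projective_module R P"
    and "f \<in> mod_hom R X Y" "g \<in> mod_hom R X Y" "u \<in> mod_hom R X P" "v \<in> mod_hom R P Y"
    and "\<And>x. x \<in> carrier X \<Longrightarrow> f x \<ominus>\<^bsub>Y\<^esub> g x = v (u x)"
  shows "(f, g) \<in> stable_rel R X Y"
  using assms unfolding stable_rel_def by blast

lemma stable_rel_hom:
  assumes "(f, g) \<in> stable_rel R X Y"
  shows "f \<in> mod_hom R X Y" "g \<in> mod_hom R X Y"
  using assms by (auto simp: stable_rel_def)

text \<open>A map to \<open>Y\<close> that factors over some projective also factors over the chosen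
  cover of \<open>Y\<close>, because the second factor lifts along \<open>prj S Y\<close>. With one
  fixed middle module, factorizations can be negated and added pointwise, which replaces direct sums
  of projectives.\<close>

lemma stable_relE:
  assumes "X \<in> fgm" "Y \<in> fgm" "(f, g) \<in> stable_rel R X Y"
  obtains u where "f \<in> mod_hom R X Y" "g \<in> mod_hom R X Y" "u \<in> mod_hom R X (cov S Y)"
    and "\<And>x. x \<in> carrier X \<Longrightarrow> f x \<ominus>\<^bsub>Y\<^esub> g x = prj S Y (u x)"
proof -
  from assms(3) obtain P u v where P: "P \<in> fgm" "projective_module R P"
    and u: "u \<in> mod_hom R X P" and v: "v \<in> mod_hom R P Y"
      and f: "f \<in> mod_hom R X Y" "g \<in> mod_hom R X Y"
    and eq: "\<And>x. x \<in> carrier X \<Longrightarrow> f x \<ominus>\<^bsub>Y\<^esub> g x = v (u x)"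
    unfolding stable_rel_def by blast
  obtain w where w: "w \<in> mod_hom R P (cov S Y)" "\<And>x. x \<in> carrier P \<Longrightarrow> prj S Y (w x) = v x"
    using projective_lift[OF P(2) prj_hom v right_module_fg right_module_fg prj_surj]
      cov_fg assms(2) by metis
  show thesis
    by (rule that[OF f compose_mod_hom[OF right_module_fg[OF assms(1)] u w(1)]])
      (simp add: compose_def eq w mod_hom_closed[OF u])
qed

lemma equiv_stable_rel:
  assumes "X \<in> fgm" "Y \<in> fgm"
  shows "equiv (mod_hom R X Y) (stable_rel R X Y)"
proof -
  interpret Y: abelian_group Y using assms by (rule_tac abelian_group_fg)
  note [simp] = assms cov_fg right_module_fg projective_cov
  have p0: "prj S Y \<zero>\<^bsub>cov S Y\<^esub> = \<zero>\<^bsub>Y\<^esub>" by (rule hom_zero) (simp_all add: prj_hom)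
  have zero: "(\<lambda>x\<in>carrier X. \<zero>\<^bsub>cov S Y\<^esub>) \<in> mod_hom R X (cov S Y)" by (rule zero_mod_hom) simp_all
  show ?thesis
  proof (rule equivI)
    show "stable_rel R X Y \<subseteq> mod_hom R X Y \<times> mod_hom R X Y" by (auto simp: stable_rel_def)
    show "refl_on (mod_hom R X Y) (stable_rel R X Y)"
    proof (rule refl_onI)
      fix f assume f: "f \<in> mod_hom R X Y"
      show "(f, f) \<in> stable_rel R X Y"
        by (rule stable_relI[OF _ _ _ f f zero prj_hom])
          (simp_all add: p0 mod_hom_closed[OF f] Y.minus_eq Y.r_neg)
    qed
    show "sym (stable_rel R X Y)"
    proof (rule symI)
      fix f g assume "(f, g) \<in> stable_rel R X Y"
      then obtain u where f: "f \<in> mod_hom R X Y" and g: "g \<in> mod_hom R X Y"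
        and u: "u \<in> mod_hom R X (cov S Y)"
        and eq: "\<And>x. x \<in> carrier X \<Longrightarrow> f x \<ominus>\<^bsub>Y\<^esub> g x = prj S Y (u x)"
        using stable_relE assms by metis
      \<comment> \<open>The negative of \<open>u\<close>, again written as zero minus
        \<open>u\<close>.\<close>
      let ?u = "\<lambda>x\<in>carrier X. (\<lambda>x\<in>carrier X. \<zero>\<^bsub>cov S Y\<^esub>) x \<ominus>\<^bsub>cov S Y\<^esub> u x"
      have u': "?u \<in> mod_hom R X (cov S Y)" by (rule diff_mod_hom[OF _ _ zero u]) simp_all
      show "(g, f) \<in> stable_rel R X Y"
      proof (rule stable_relI[OF _ _ _ g f u' prj_hom])
        fix x assume x: "x \<in> carrier X"
        have "prj S Y (?u x) = prj S Y \<zero>\<^bsub>cov S Y\<^esub> \<ominus>\<^bsub>Y\<^esub> prj S Y (u x)"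
          using x mod_hom_closed[OF u x] abelian_group_fg[of "cov S Y"]
          by (simp add: hom_minus[OF _ _ prj_hom] abelian_group.axioms(1)
            abelian_monoid.zero_closed)
        then show "g x \<ominus>\<^bsub>Y\<^esub> f x = prj S Y (?u x)"
          using x mod_hom_closed[OF f] mod_hom_closed[OF g]
          by (simp add: p0 eq[symmetric] Y.minus_eq Y.minus_add Y.a_comm)
      qed simp_all
    qed
    show "trans (stable_rel R X Y)"
    proof (rule transI)
      fix f g h assume fg: "(f, g) \<in> stable_rel R X Y" and gh: "(g, h) \<in> stable_rel R X Y"
      from stable_relE[OF assms fg] obtain u where f: "f \<in> mod_hom R X Y" and g: "g \<in> mod_hom R X Y"
        and u: "u \<in> mod_hom R X (cov S Y)"
          and eq: "\<And>x. x \<in> carrier X \<Longrightarrow> f x \<ominus>\<^bsub>Y\<^esub> g x = prj S Y (u x)"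
        by metis
      from stable_relE[OF assms gh] obtain v where h: "h \<in> mod_hom R X Y"
        and v: "v \<in> mod_hom R X (cov S Y)" and eq': "\<And>x. x \<in> carrier X \<Longrightarrow> g x \<ominus>\<^bsub>Y\<^esub> h x = prj S Y (v x)"
        by metis
      have uv: "(\<lambda>x\<in>carrier X. u x \<oplus>\<^bsub>cov S Y\<^esub> v x) \<in> mod_hom R X (cov S Y)"
        by (rule add_mod_hom[OF _ _ u v]) simp_all
      show "(f, h) \<in> stable_rel R X Y"
      proof (rule stable_relI[OF _ _ _ f h uv prj_hom])
        fix x assume x: "x \<in> carrier X"
        then have "f x \<ominus>\<^bsub>Y\<^esub> h x = (f x \<ominus>\<^bsub>Y\<^esub> g x) \<oplus>\<^bsub>Y\<^esub> (g x \<ominus>\<^bsub>Y\<^esub> h x)"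
          using mod_hom_closed[OF f] mod_hom_closed[OF g] mod_hom_closed[OF h]
          by (simp add: Y.minus_telescope)
        then show "f x \<ominus>\<^bsub>Y\<^esub> h x = prj S Y ((\<lambda>x\<in>carrier X. u x \<oplus>\<^bsub>cov S Y\<^esub> v x) x)"
          using x mod_hom_closed[OF u] mod_hom_closed[OF v]
          by (simp add: eq eq' mod_hom_add[OF prj_hom])
      qed simp_all
    qed
  qed
qed

lemma stable_class_eq_iff:
  assumes "X \<in> fgm" "Y \<in> fgm" "f \<in> mod_hom R X Y" "g \<in> mod_hom R X Y"
  shows "stable_class R X Y f = stable_class R X Y g \<longleftrightarrow> (f, g) \<in> stable_rel R X Y"
  unfolding stable_class_def using eq_equiv_class_iff[OF equiv_stable_rel] assms by blast

lemma in_stable_class: "g \<in> stable_class R X Y f \<longleftrightarrow> (f, g) \<in> stable_rel R X Y"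
  by (simp add: stable_class_def)

lemma stable_class_self:
  assumes "X \<in> fgm" "Y \<in> fgm" "f \<in> mod_hom R X Y"
  shows "f \<in> stable_class R X Y f"
  using equiv_stable_rel[OF assms(1,2)] assms(3)
  unfolding in_stable_class by (metis equiv_def refl_onD)

text \<open>One factor is changed at a time. The difference of \<open>g f\<close> and
  \<open>g' f\<close> factors over the cover of \<open>Z\<close> as \<open>prj S Z\<close> after
  \<open>v f\<close>; that of \<open>g' f\<close> and \<open>g' f'\<close> factors over the cover of
  \<open>Y\<close> through \<open>u\<close>. Transitivity joins the two.\<close>

lemma stable_rel_compose:
  assumes "X \<in> fgm" "Y \<in> fgm" "Z \<in> fgm"
    and f: "(f, f') \<in> stable_rel R X Y" and g: "(g, g') \<in> stable_rel R Y Z"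
  shows "(compose (carrier X) g f, compose (carrier X) g' f') \<in> stable_rel R X Z"
proof -
  note [simp] = assms(1-3) cov_fg right_module_fg projective_cov
  from stable_relE[OF assms(1,2) f] obtain u where f: "f \<in> mod_hom R X Y" "f' \<in> mod_hom R X Y"
    and u: "u \<in> mod_hom R X (cov S Y)" and eq: "\<And>x. x \<in> carrier X \<Longrightarrow> f x \<ominus>\<^bsub>Y\<^esub> f' x = prj S Y (u x)"
    by metis
  from stable_relE[OF assms(2,3) g] obtain v where g: "g \<in> mod_hom R Y Z" "g' \<in> mod_hom R Y Z"
    and v: "v \<in> mod_hom R Y (cov S Z)" and eq': "\<And>x. x \<in> carrier Y \<Longrightarrow> g x \<ominus>\<^bsub>Z\<^esub> g' x = prj S Z (v x)"
    by metis
  note c = compose_mod_hom[OF right_module_fg[OF assms(1)]]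
  have "(compose (carrier X) g f, compose (carrier X) g' f) \<in> stable_rel R X Z"
    by (rule stable_relI[OF _ _ _ c[OF f(1) g(1)] c[OF f(1) g(2)] c[OF f(1) v] prj_hom])
      (simp_all add: compose_def eq' mod_hom_closed[OF f(1)])
  moreover have "(compose (carrier X) g' f, compose (carrier X) g' f') \<in> stable_rel R X Z"
  proof (rule stable_relI[OF _ _ _ c[OF f(1) g(2)] c[OF f(2) g(2)] u])
    show "compose (carrier (cov S Y)) g' (prj S Y) \<in> mod_hom R (cov S Y) Z"
      by (rule compose_mod_hom[OF _ prj_hom g(2)]) simp_all
    show "compose (carrier X) g' f x \<ominus>\<^bsub>Z\<^esub> compose (carrier X) g' f' x
        = compose (carrier (cov S Y)) g' (prj S Y) (u x)" if "x \<in> carrier X" for x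
      using that mod_hom_closed[OF u that] mod_hom_closed[OF f(1)] mod_hom_closed[OF f(2)]
      by (simp add: compose_def eq[symmetric] hom_minus[OF _ _ g(2)])
  qed simp_all
  ultimately show ?thesis
    using equiv_stable_rel[OF assms(1,3)] by (auto simp: equiv_def dest: transD)
qed

lemma stable_mod_simps:
  "Obj (stable_mod R) = fgm"
  "Hom (stable_mod R) X Y = mod_hom R X Y // stable_rel R X Y"
  "Ident (stable_mod R) X = stable_class R X X (\<lambda>x\<in>carrier X. x)"
  by (simp_all add: stable_mod_def)

lemma stable_Hom_iff:
  "F \<in> Hom (stable_mod R) X Y \<longleftrightarrow> (\<exists>f\<in>mod_hom R X Y. F = stable_class R X Y f)"
  by (auto simp: stable_mod_simps quotient_def stable_class_def)

lemma stable_class_in_Hom: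
  "f \<in> mod_hom R X Y \<Longrightarrow> stable_class R X Y f \<in> Hom (stable_mod R) X Y"
  by (auto simp: stable_Hom_iff)

text \<open>Composition is defined as a union over all representatives. All members of this union
  are the same class, and both index sets are nonempty because a class contains its representative;
  so the union collapses.\<close>

lemma stable_Comp:
  assumes "X \<in> fgm" "Y \<in> fgm" "Z \<in> fgm"
    and "f \<in> mod_hom R X Y" "g \<in> mod_hom R Y Z"
  shows "Comp (stable_mod R) X Y Z (stable_class R Y Z g) (stable_class R X Y f)
    = stable_class R X Z (compose (carrier X) g f)"
proof -
  have "stable_class R X Z (compose (carrier X) g' f') = stable_class R X Z (compose
    (carrier X) g f)"
    if "g' \<in> stable_class R Y Z g" "f' \<in> stable_class R X Y f" for g' f'
  proof -
    have "(compose (carrier X) g f, compose (carrier X) g' f') \<in> stable_rel R X Z"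
      using that by (intro stable_rel_compose[OF assms(1-3)]) (simp_all add: in_stable_class)
    then show ?thesis
      using stable_class_eq_iff[OF assms(1,3)] stable_rel_hom by metis
  qed
  then have "Comp (stable_mod R) X Y Z (stable_class R Y Z g) (stable_class R X Y f)
    = (\<Union>g'\<in>stable_class R Y Z g. \<Union>f'\<in>stable_class R X Y f.
        stable_class R X Z (compose (carrier X) g f))"
    by (simp add: stable_mod_def)
  also have "\<dots> = stable_class R X Z (compose (carrier X) g f)"
    using stable_class_self[OF assms(1,2,4)] stable_class_self[OF assms(2,3,5)] by auto
  finally show ?thesis .
qed

lemma category_stable_mod: "category (stable_mod R :: (('a, 'm) module, ('m \<Rightarrow> 'm) set) category)"
proof
  fix W X Y Z :: "('a, 'm) module" and F G H
  assume W: "W \<in> Obj (stable_mod R)" and X: "X \<in> Obj (stable_mod R)"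
    and Y: "Y \<in> Obj (stable_mod R)" and Z: "Z \<in> Obj (stable_mod R)"
    and F: "F \<in> Hom (stable_mod R) W X" and G: "G \<in> Hom (stable_mod R) X Y"
    and H: "H \<in> Hom (stable_mod R) Y Z"
  note WXYZ = W X Y Z
  note [simp] = WXYZ[unfolded stable_mod_simps] right_module_fg
  from F G H obtain f g h where f: "f \<in> mod_hom R W X" "F = stable_class R W X f"
    and g: "g \<in> mod_hom R X Y" "G = stable_class R X Y g" and h: "h \<in> mod_hom R Y Z" "H
      = stable_class R Y Z h"
    by (auto simp: stable_Hom_iff)
  have "compose (carrier W) h (compose (carrier W) g f) = compose (carrier W) (compose
    (carrier X) h g) f"
    using mod_hom_closed[OF f(1)] by (auto simp: compose_def)
  then show "Comp (stable_mod R) W Y Z H (Comp (stable_mod R) W X Y G F)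
      = Comp (stable_mod R) W X Z (Comp (stable_mod R) X Y Z H G) F"
    unfolding f g h 
    by (simp add: stable_Comp compose_mod_hom[OF _ f(1) g(1)] compose_mod_hom[OF _ g(1) h(1)]
        f(1) g(1) h(1))
next
  fix X Y Z :: "('a, 'm) module" and F G
  assume "X \<in> Obj (stable_mod R)" "Y \<in> Obj (stable_mod R)" "Z \<in> Obj (stable_mod R)"
    and "F \<in> Hom (stable_mod R) X Y" and "G \<in> Hom (stable_mod R) Y Z"
  then show "Comp (stable_mod R) X Y Z G F \<in> Hom (stable_mod R) X Z"
    by (auto simp: stable_Hom_iff[of F] stable_Hom_iff[of G] stable_mod_simps(1) stable_Comp
        intro!: stable_class_in_Hom compose_mod_hom right_module_fg)
next
  fix X :: "('a, 'm) module" assume "X \<in> Obj (stable_mod R)"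
  then show "Ident (stable_mod R) X \<in> Hom (stable_mod R) X X"
    by (auto simp: stable_mod_simps(1,3) intro!: stable_class_in_Hom ident_mod_hom right_module_fg)
next
  fix X Y :: "('a, 'm) module" and F
  assume X: "X \<in> Obj (stable_mod R)" and Y: "Y \<in> Obj (stable_mod R)"
    and F: "F \<in> Hom (stable_mod R) X Y"
  note XY = X[unfolded stable_mod_simps] Y[unfolded stable_mod_simps]
  from F obtain f where f: "f \<in> mod_hom R X Y" "F = stable_class R X Y f" by (auto
    simp: stable_Hom_iff)
  \<comment> \<open>These are equalities of functions, not only of values on the carrier, because
    \<open>f\<close> is extensional.\<close>
  have "compose (carrier X) f (\<lambda>x\<in>carrier X. x) = f" "compose (carrier X) (\<lambda>x\<in>carrier Y. x) f = f"
    using f(1) mod_hom_closed[OF f(1)]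
    by (auto simp: compose_def mod_hom_iff extensional_def)
  then show "Comp (stable_mod R) X X Y F (Ident (stable_mod R) X) = F"
    and "Comp (stable_mod R) X Y Y (Ident (stable_mod R) Y) F = F"
    unfolding f stable_mod_simps using XY f
    by (simp_all add: stable_Comp ident_mod_hom right_module_fg)
qed

section \<open>Morphisms of the chosen sequences and functoriality of the Heller operator\<close>

lemma lift_through_prj:
  assumes "P \<in> fgm" "projective_module R P" "Y \<in> fgm" "f \<in> mod_hom R P Y"
  obtains g where "g \<in> mod_hom R P (cov S Y)" and "\<And>x. x \<in> carrier P \<Longrightarrow> prj S Y (g x) = f x"
  using projective_lift[OF assms(2) prj_hom assms(4) right_module_fg right_module_fg prj_surj]
    cov_fg assms(3) by metis

lemma factor_through_inc:
  assumes "W \<in> fgm" "Y \<in> fgm" "g \<in> mod_hom R W (cov S Y)"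
    and "\<And>x. x \<in> carrier W \<Longrightarrow> prj S Y (g x) = \<zero>\<^bsub>Y\<^esub>"
  obtains s where "s \<in> mod_hom R W (syz S Y)" and "\<And>x. x \<in> carrier W \<Longrightarrow> inc S Y (s x) = g x"
  using kernel_lift[OF short_exact_syz right_module_fg right_module_fg assms(3)]
    syz_fg assms by metis

text \<open>The composite of \<open>f\<close> with \<open>prj S X\<close> lifts along
  \<open>prj S Y\<close> since the cover of \<open>X\<close> is projective; the lift sends the
  kernel of \<open>prj S X\<close> into that of \<open>prj S Y\<close>, which yields the map of
  syzygies.\<close>

lemma ses_morphism_exists:
  assumes "X \<in> fgm" "Y \<in> fgm" "f \<in> mod_hom R X Y"
  obtains f' fh where "ses_morphism R S X Y f' fh f"
proof -
  note [simp] = assms(1,2) cov_fg syz_fg right_module_fg projective_cov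
  have "compose (carrier (cov S X)) f (prj S X) \<in> mod_hom R (cov S X) Y"
    by (rule compose_mod_hom[OF _ prj_hom assms(3)]) simp_all
  then obtain fh where fh: "fh \<in> mod_hom R (cov S X) (cov S Y)"
    and eq: "\<And>x. x \<in> carrier (cov S X) \<Longrightarrow> prj S Y (fh x) = compose (carrier (cov S X)) f (prj S X) x"
    by (rule lift_through_prj[rotated 3]) simp_all
  have "compose (carrier (syz S X)) fh (inc S X) \<in> mod_hom R (syz S X) (cov S Y)"
    by (rule compose_mod_hom[OF _ inc_hom fh]) simp_all
  moreover have "prj S Y (compose (carrier (syz S X)) fh (inc S X) x) = \<zero>\<^bsub>Y\<^esub>"
    if "x \<in> carrier (syz S X)" for x
    using that by (simp add: compose_def eq mod_hom_closed[OF inc_hom] prj_inc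
        hom_zero[OF assms(1) assms(2) assms(3)])
  ultimately obtain f' where "f' \<in> mod_hom R (syz S X) (syz S Y)"
    and "\<And>x. x \<in> carrier (syz S X) \<Longrightarrow> inc S Y (f' x) = compose (carrier (syz S X)) fh (inc S X) x"
    by (rule factor_through_inc[rotated 2]) simp_all
  with fh eq assms(3) have "ses_morphism R S X Y f' fh f"
    by (simp add: ses_morphism_def compose_def)
  then show thesis by (rule that)
qed

text \<open>This is the homotopy argument, and it settles independence of the representative and of
  the lift at once. If \<open>f - g\<close> equals \<open>prj S Y\<close> after \<open>u\<close>,
  then \<open>fh - gh\<close> and \<open>u\<close> after \<open>prj S X\<close> have the same image
  in \<open>Y\<close>, so they differ by a map \<open>s\<close> into the syzygy of \<open>Y\<close>.
  On the syzygy of \<open>X\<close> the map \<open>prj S X\<close> vanishes, hence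
  \<open>f' - g'\<close> is \<open>s\<close> after \<open>inc S X\<close> and factors over the cover
  of \<open>X\<close>.\<close>

lemma ses_morphism_stable_rel:
  assumes "X \<in> fgm" "Y \<in> fgm"
    and F: "ses_morphism R S X Y f' fh f" and G: "ses_morphism R S X Y g' gh g"
    and "(f, g) \<in> stable_rel R X Y"
  shows "(f', g') \<in> stable_rel R (syz S X) (syz S Y)"
proof -
  note [simp] = assms(1,2) cov_fg syz_fg right_module_fg projective_cov
  interpret Y: abelian_group Y by (rule abelian_group_fg) simp
  interpret cY: abelian_group "cov S Y" by (rule abelian_group_fg) simp
  from F have f': "f' \<in> mod_hom R (syz S X) (syz S Y)" and fh: "fh \<in> mod_hom R (cov S X) (cov S Y)"
    and f: "f \<in> mod_hom R X Y" and f1: "\<And>x. x \<in> carrier (syz S X) \<Longrightarrow> fh (inc S X x) = inc S Y (f' x)"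
    and f2: "\<And>x. x \<in> carrier (cov S X) \<Longrightarrow> prj S Y (fh x) = f (prj S X x)"
    by (auto simp: ses_morphism_def)
  from G have g': "g' \<in> mod_hom R (syz S X) (syz S Y)" and gh: "gh \<in> mod_hom R (cov S X) (cov S Y)"
    and g: "g \<in> mod_hom R X Y" and g1: "\<And>x. x \<in> carrier (syz S X) \<Longrightarrow> gh (inc S X x) = inc S Y (g' x)"
    and g2: "\<And>x. x \<in> carrier (cov S X) \<Longrightarrow> prj S Y (gh x) = g (prj S X x)"
    by (auto simp: ses_morphism_def)
  from stable_relE[OF assms(1,2,5)] obtain u where u: "u \<in> mod_hom R X (cov S Y)"
    and eq: "\<And>x. x \<in> carrier X \<Longrightarrow> f x \<ominus>\<^bsub>Y\<^esub> g x = prj S Y (u x)"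
    by metis
  define d where "d = (\<lambda>x\<in>carrier (cov S X). fh x \<ominus>\<^bsub>cov S Y\<^esub> gh x)"
  have d: "d \<in> mod_hom R (cov S X) (cov S Y)"
    unfolding d_def by (rule diff_mod_hom[OF _ _ fh gh]) simp_all
  have up: "compose (carrier (cov S X)) u (prj S X) \<in> mod_hom R (cov S X) (cov S Y)" (is "?up \<in> _")
    by (rule compose_mod_hom[OF _ prj_hom u]) simp_all
  define k where "k = (\<lambda>x\<in>carrier (cov S X). d x \<ominus>\<^bsub>cov S Y\<^esub> ?up x)"
  have k: "k \<in> mod_hom R (cov S X) (cov S Y)"
    unfolding k_def by (rule diff_mod_hom[OF _ _ d up]) simp_all
  have "prj S Y (k x) = \<zero>\<^bsub>Y\<^esub>" if x: "x \<in> carrier (cov S X)" for x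
  proof -
    have px: "prj S X x \<in> carrier X" using x by (simp add: mod_hom_closed[OF prj_hom])
    have "prj S Y (k x) = (f (prj S X x) \<ominus>\<^bsub>Y\<^esub> g (prj S X x)) \<ominus>\<^bsub>Y\<^esub> prj S Y (u (prj S X x))"
      using x px by (simp add: k_def d_def compose_def hom_minus[OF _ _ prj_hom]
          mod_hom_closed[OF fh] mod_hom_closed[OF gh] mod_hom_closed[OF u] cY.minus_closed f2 g2)
    then show ?thesis
      using px by (simp add: eq Y.minus_eq_zero_iff mod_hom_closed[OF u] mod_hom_closed[OF prj_hom])
  qed
  with k obtain s where s: "s \<in> mod_hom R (cov S X) (syz S Y)"
    and inc_s: "\<And>x. x \<in> carrier (cov S X) \<Longrightarrow> inc S Y (s x) = k x"
    by (rule factor_through_inc[rotated 2]) simp_all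
  show ?thesis
  proof (rule stable_relI[OF _ _ _ f' g' inc_hom s])
    fix x assume x: "x \<in> carrier (syz S X)"
    interpret sY: abelian_group "syz S Y" by (rule abelian_group_fg) simp
    have ix: "inc S X x \<in> carrier (cov S X)" using x by (simp add: mod_hom_closed[OF inc_hom])
    have "inc S Y (f' x \<ominus>\<^bsub>syz S Y\<^esub> g' x) = fh (inc S X x) \<ominus>\<^bsub>cov S Y\<^esub> gh (inc S X x)"
      using x by (simp add: hom_minus[OF _ _ inc_hom] mod_hom_closed[OF f']
        mod_hom_closed[OF g'] f1 g1)
    also have "\<dots> = k (inc S X x)"
      using x ix mod_hom_closed[OF fh ix] mod_hom_closed[OF gh ix]
      by (simp add: k_def d_def compose_def prj_inc hom_zero[OF _ _ u] cY.minus_eq)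
    also have "\<dots> = inc S Y (s (inc S X x))" using ix by (simp add: inc_s)
    finally show "f' x \<ominus>\<^bsub>syz S Y\<^esub> g' x = s (inc S X x)"
      using x ix by - (rule inj_onD[OF inc_inj[OF assms(2)]],
        simp_all add: mod_hom_closed[OF f'] mod_hom_closed[OF g']
          mod_hom_closed[OF s] sY.minus_closed)
  qed simp_all
qed

text \<open>The \<open>SOME\<close> in \<open>heller\<close> may pick another representative of the
  class and another lift; by the homotopy argument its stable class is the same. From here on the
  arrow part can be computed from any convenient morphism of sequences.\<close>

lemma heller_stable_class:
  assumes "X \<in> fgm" "Y \<in> fgm" and "ses_morphism R S X Y f' fh f"
  shows "on_mor (heller R S) X Y (stable_class R X Y f) = stable_class R (syz S X) (syz S Y) f'"
proof -
  let ?P = "\<lambda>f'. \<exists>g\<in>stable_class R X Y f. \<exists>fh. ses_morphism R S X Y f' fh g"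
  have f: "f \<in> mod_hom R X Y" using assms(3) by (simp add: ses_morphism_def)
  have "?P f'" using assms(3) stable_class_self[OF assms(1,2) f] by blast
  define e where "e = (SOME f'. ?P f')"
  from \<open>?P f'\<close> have "?P e" unfolding e_def by (rule someI[of ?P])
  then obtain g gh where "(f, g) \<in> stable_rel R X Y" "ses_morphism R S X Y e gh g"
    by (auto simp: in_stable_class)
  then have "(f', e) \<in> stable_rel R (syz S X) (syz S Y)"
    using ses_morphism_stable_rel[OF assms(1,2,3)] by blast
  then have "stable_class R (syz S X) (syz S Y) f' = stable_class R (syz S X) (syz S Y) e"
    using stable_class_eq_iff[OF syz_fg[OF assms(1)] syz_fg[OF assms(2)]] stable_rel_hom by blast
  then show ?thesis by (simp add: heller_def e_def)
qed

text \<open>The identities form a lift of the identity, and composing lifts gives a lift of the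
  composite; since any lift computes the class, the choices need not be compatible with each
  other.\<close>

lemma heller_is_functor: "is_functor (stable_mod R) (stable_mod R) (heller R S)"
proof (intro is_functor.intro category_stable_mod is_functor_axioms.intro)
  have obj: "on_obj (heller R S) = syz S" by (simp add: heller_def)
  {
    fix X :: "('a, 'm) module" assume "X \<in> Obj (stable_mod R)"
    then have X: "X \<in> fgm" by (simp add: stable_mod_simps)
    then show "on_obj (heller R S) X \<in> Obj (stable_mod R)"
      by (simp add: obj stable_mod_simps syz_fg)
    have "ses_morphism R S X X (\<lambda>x\<in>carrier (syz S X). x) (\<lambda>x\<in>carrier (cov S X). x)
      (\<lambda>x\<in>carrier X. x)"
      using X by (simp add: ses_morphism_def ident_mod_hom right_module_fg syz_fg cov_fg
          mod_hom_closed[OF inc_hom] mod_hom_closed[OF prj_hom])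
    then show "on_mor (heller R S) X X (Ident (stable_mod R) X) = Ident (stable_mod R)
      (on_obj (heller R S) X)"
      using X by (simp add: obj stable_mod_simps heller_stable_class)
  next
    fix X Y :: "('a, 'm) module" and F
    assume "X \<in> Obj (stable_mod R)" "Y \<in> Obj (stable_mod R)" "F \<in> Hom (stable_mod R) X Y"
    then obtain f where XY: "X \<in> fgm" "Y \<in> fgm" and f: "f \<in> mod_hom R X Y"
      and F: "F = stable_class R X Y f"
      by (auto simp: stable_mod_simps(1) stable_Hom_iff)
    obtain f' fh where ses: "ses_morphism R S X Y f' fh f" using ses_morphism_exists[OF XY f] .
    then have "f' \<in> mod_hom R (syz S X) (syz S Y)" by (simp add: ses_morphism_def)
    then show "on_mor (heller R S) X Y F \<in> Hom (stable_mod R) (on_obj (heller R S) X)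
      (on_obj (heller R S) Y)"
      unfolding F obj heller_stable_class[OF XY ses] by (rule stable_class_in_Hom)
  next
    fix X Y Z :: "('a, 'm) module" and F G
    assume "X \<in> Obj (stable_mod R)" "Y \<in> Obj (stable_mod R)" "Z \<in> Obj (stable_mod R)"
      "F \<in> Hom (stable_mod R) X Y" "G \<in> Hom (stable_mod R) Y Z"
    then obtain f g where XYZ: "X \<in> fgm" "Y \<in> fgm" "Z \<in> fgm"
      and f: "f \<in> mod_hom R X Y" "F = stable_class R X Y f"
      and g: "g \<in> mod_hom R Y Z" "G = stable_class R Y Z g"
      by (auto simp: stable_mod_simps(1) stable_Hom_iff)
    obtain f' fh where sf: "ses_morphism R S X Y f' fh f"
      using ses_morphism_exists[OF XYZ(1,2) f(1)] .
    obtain g' gh where sg: "ses_morphism R S Y Z g' gh g"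
      using ses_morphism_exists[OF XYZ(2,3) g(1)] .
    note sf' = sf[unfolded ses_morphism_def] and sg' = sg[unfolded ses_morphism_def]
    have f': "f' \<in> mod_hom R (syz S X) (syz S Y)" and fh: "fh \<in> mod_hom R (cov S X) (cov S Y)"
      using sf' by auto
    have g': "g' \<in> mod_hom R (syz S Y) (syz S Z)" and gh: "gh \<in> mod_hom R (cov S Y) (cov S Z)"
      using sg' by auto
    have "ses_morphism R S X Z (compose (carrier (syz S X)) g' f')
      (compose (carrier (cov S X)) gh fh)
        (compose (carrier X) g f)"
      using XYZ sf' sg' unfolding ses_morphism_def
      by (simp add: compose_mod_hom[OF _ f' g'] compose_mod_hom[OF _ fh gh]
          compose_mod_hom[OF _ f(1) g(1)] right_module_fg syz_fg cov_fg)
        (simp add: compose_def mod_hom_closed[OF inc_hom] mod_hom_closed[OF prj_hom]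
          mod_hom_closed[OF f'] mod_hom_closed[OF fh])
    then show "on_mor (heller R S) X Z (Comp (stable_mod R) X Y Z G F)
      = Comp (stable_mod R) (on_obj (heller R S) X) (on_obj (heller R S) Y) (on_obj (heller R S) Z)
          (on_mor (heller R S) Y Z G) (on_mor (heller R S) X Y F)"
      unfolding f(2) g(2) obj using XYZ f(1) g(1) f' g' sf sg
      by (simp add: stable_Comp syz_fg heller_stable_class[OF _ _ sf]
        heller_stable_class[OF _ _ sg])
        (simp add: heller_stable_class)
  }
qed

end


section \<open>Left adjoints from universal arrows\<close>

text \<open>The adjunction bijection sends \<open>u\<close> to \<open>G u\<close> composed with the
  universal arrow, and universality says precisely that it is bijective. On arrows,
  \<open>F k\<close> is forced: it is the unique map whose image under the bijection is
  \<open>k\<close> followed by the universal arrow.\<close>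

lemma has_left_adjoint_if_universal_arrows:
  assumes "is_functor C D G"
    and universal: "\<And>X. X \<in> Obj D \<Longrightarrow> \<exists>Z\<in>Obj C. \<exists>\<eta>\<in>Hom D X (on_obj G Z).
      \<forall>Y\<in>Obj C. \<forall>f\<in>Hom D X (on_obj G Y).
        \<exists>!h. h \<in> Hom C Z Y \<and> Comp D X (on_obj G Z) (on_obj G Y) (on_mor G Z Y h) \<eta> = f"
  shows "has_left_adjoint C D G"
proof -
  interpret G: is_functor C D G by fact
  \<comment> \<open>The restriction to objects moves inside the existential quantifiers, so that
    \<open>choice\<close> yields total functions with arbitrary values off the objects.\<close>
  from universal have "\<forall>X. \<exists>Z \<eta>. X \<in> Obj D \<longrightarrow> Z \<in> Obj C \<and> \<eta> \<in> Hom D X (on_obj G Z) \<and>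
      (\<forall>Y\<in>Obj C. \<forall>f\<in>Hom D X (on_obj G Y).
        \<exists>!h. h \<in> Hom C Z Y \<and> Comp D X (on_obj G Z) (on_obj G Y) (on_mor G Z Y h) \<eta> = f)"
    by blast
  then obtain L where "\<forall>X. \<exists>\<eta>. X \<in> Obj D \<longrightarrow> L X \<in> Obj C \<and> \<eta> \<in> Hom D X (on_obj G (L X)) \<and>
      (\<forall>Y\<in>Obj C. \<forall>f\<in>Hom D X (on_obj G Y).
        \<exists>!h. h \<in> Hom C (L X) Y \<and>
          Comp D X (on_obj G (L X)) (on_obj G Y) (on_mor G (L X) Y h) \<eta> = f)"
    by (rule choice[THEN exE]) blast
  then obtain \<eta> where L: "\<And>X. X \<in> Obj D \<Longrightarrow> L X \<in> Obj C"
    and \<eta>: "\<And>X. X \<in> Obj D \<Longrightarrow> \<eta> X \<in> Hom D X (on_obj G (L X))"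
    and uniq: "\<And>X Y f. \<lbrakk>X \<in> Obj D; Y \<in> Obj C; f \<in> Hom D X (on_obj G Y)\<rbrakk>
      \<Longrightarrow> \<exists>!h. h \<in> Hom C (L X) Y \<and>
          Comp D X (on_obj G (L X)) (on_obj G Y) (on_mor G (L X) Y h) (\<eta> X) = f"
    by (rule choice[THEN exE]) blast
  define \<Phi> where
    "\<Phi> X Y u = Comp D X (on_obj G (L X)) (on_obj G Y) (on_mor G (L X) Y u) (\<eta> X)" for X Y u
  define ext where "ext X Y f = (THE h. h \<in> Hom C (L X) Y \<and> \<Phi> X Y h = f)" for X Y f
  have ext: "ext X Y f \<in> Hom C (L X) Y" "\<Phi> X Y (ext X Y f) = f"
    if "X \<in> Obj D" "Y \<in> Obj C" "f \<in> Hom D X (on_obj G Y)" for X Y f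
    using theI'[OF uniq[OF that, folded \<Phi>_def]] by (simp_all add: ext_def)
  have eqI: "h = h'"
    if "X \<in> Obj D" "Y \<in> Obj C" "h \<in> Hom C (L X) Y" "h' \<in> Hom C (L X) Y" "\<Phi> X Y h = \<Phi> X Y h'"
    for X Y h h'
  proof -
    have "\<Phi> X Y h' \<in> Hom D X (on_obj G Y)"
      unfolding \<Phi>_def using that L \<eta>
      by (intro G.cod.Comp_in_Hom G.on_mor_in_Hom G.on_obj_in_Obj) auto
    then show ?thesis using uniq[folded \<Phi>_def] that by blast
  qed
  have \<Phi>_in: "\<Phi> X Y u \<in> Hom D X (on_obj G Y)"
    if "X \<in> Obj D" "Y \<in> Obj C" "u \<in> Hom C (L X) Y" for X Y u
    unfolding \<Phi>_def using that L \<eta>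
    by (intro G.cod.Comp_in_Hom G.on_mor_in_Hom G.on_obj_in_Obj) auto
  have \<Phi>_Comp: "\<Phi> X Y' (Comp C (L X) Y Y' h u)
      = Comp D X (on_obj G Y) (on_obj G Y') (on_mor G Y Y' h) (\<Phi> X Y u)"
    if "X \<in> Obj D" "Y \<in> Obj C" "Y' \<in> Obj C" "u \<in> Hom C (L X) Y" "h \<in> Hom C Y Y'" for X Y Y' u h
    unfolding \<Phi>_def using that L \<eta>
    by (simp add: G.on_mor_Comp G.cod.Comp_assoc G.on_mor_in_Hom G.on_obj_in_Obj)
  define F where "F = \<lparr>on_obj = L,
    on_mor = (\<lambda>X X' k. ext X (L X') (Comp D X X' (on_obj G (L X')) (\<eta> X') k))\<rparr>"
  have F_obj: "on_obj F = L" by (simp add: F_def)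
  have F_in: "on_mor F X X' k \<in> Hom C (L X) (L X')"
    and F_\<Phi>: "\<Phi> X (L X') (on_mor F X X' k) = Comp D X X' (on_obj G (L X')) (\<eta> X') k"
    if "X \<in> Obj D" "X' \<in> Obj D" "k \<in> Hom D X X'" for X X' k
  proof -
    have "Comp D X X' (on_obj G (L X')) (\<eta> X') k \<in> Hom D X (on_obj G (L X'))"
      using that L \<eta> by (intro G.cod.Comp_in_Hom G.on_obj_in_Obj) auto
    then show "on_mor F X X' k \<in> Hom C (L X) (L X')"
      and "\<Phi> X (L X') (on_mor F X X' k) = Comp D X X' (on_obj G (L X')) (\<eta> X') k"
      using that L by (simp_all add: F_def ext)
  qed
  \<comment> \<open>Naturality in the first argument is obtained before \<open>F\<close> is known to
    be a functor, since preservation of composition is deduced from it by injectivity of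
    \<open>\<Phi>\<close>.\<close>
  have natural: "\<Phi> X' Y (Comp C (L X') (L X) Y u (on_mor F X' X k))
      = Comp D X' X (on_obj G Y) (\<Phi> X Y u) k"
    if "X' \<in> Obj D" "X \<in> Obj D" "Y \<in> Obj C" "k \<in> Hom D X' X" "u \<in> Hom C (L X) Y" for X' X Y k u
  proof -
    have "\<Phi> X' Y (Comp C (L X') (L X) Y u (on_mor F X' X k))
        = Comp D X' (on_obj G (L X)) (on_obj G Y) (on_mor G (L X) Y u)
            (Comp D X' X (on_obj G (L X)) (\<eta> X) k)"
      using that L by (simp add: \<Phi>_Comp F_in F_\<Phi>)
    also have "\<dots> = Comp D X' X (on_obj G Y) (\<Phi> X Y u) k"
      unfolding \<Phi>_def using that L \<eta>
      by (intro G.cod.Comp_assoc G.on_mor_in_Hom G.on_obj_in_Obj) auto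
    finally show ?thesis .
  qed
  have "is_functor D C F"
  proof (intro is_functor.intro is_functor_axioms.intro G.dom.category_axioms G.cod.category_axioms)
    show "on_mor F X X (Ident D X) = Ident C (on_obj F X)" if "X \<in> Obj D" for X
      unfolding F_obj
    proof (rule eqI[OF that L[OF that] F_in L[OF that, THEN G.dom.Ident_in_Hom]])
      show "\<Phi> X (L X) (on_mor F X X (Ident D X)) = \<Phi> X (L X) (Ident C (L X))"
        using that L \<eta> G.cod.Ident_in_Hom
        by (simp add: F_\<Phi>) (simp add: \<Phi>_def G.on_mor_Ident G.cod.Comp_Ident_left
            G.cod.Comp_Ident_right G.on_obj_in_Obj)
    qed (use that G.cod.Ident_in_Hom in auto)
    show "on_mor F X Z (Comp D X Y Z g f)
        = Comp C (on_obj F X) (on_obj F Y) (on_obj F Z) (on_mor F Y Z g) (on_mor F X Y f)"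
      if o: "X \<in> Obj D" "Y \<in> Obj D" "Z \<in> Obj D" and f: "f \<in> Hom D X Y" and g: "g \<in> Hom D Y Z"
      for X Y Z f g
      unfolding F_obj
    proof (rule eqI[OF o(1) L[OF o(3)]])
      have gf: "Comp D X Y Z g f \<in> Hom D X Z" using o f g by (rule G.cod.Comp_in_Hom)
      show "on_mor F X Z (Comp D X Y Z g f) \<in> Hom C (L X) (L Z)" using o(1,3) gf by (rule F_in)
      show "Comp C (L X) (L Y) (L Z) (on_mor F Y Z g) (on_mor F X Y f) \<in> Hom C (L X) (L Z)"
        using o f g L by (intro G.dom.Comp_in_Hom F_in) auto
      have "\<Phi> X (L Z) (Comp C (L X) (L Y) (L Z) (on_mor F Y Z g) (on_mor F X Y f))
          = Comp D X Y (on_obj G (L Z)) (Comp D Y Z (on_obj G (L Z)) (\<eta> Z) g) f"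
        using o f g L by (simp add: natural F_in F_\<Phi>)
      also have "\<dots> = \<Phi> X (L Z) (on_mor F X Z (Comp D X Y Z g f))"
        using o f g gf L \<eta> by (simp add: F_\<Phi> G.cod.Comp_assoc G.on_obj_in_Obj)
      finally show "\<Phi> X (L Z) (on_mor F X Z (Comp D X Y Z g f))
          = \<Phi> X (L Z) (Comp C (L X) (L Y) (L Z) (on_mor F Y Z g) (on_mor F X Y f))" ..
    qed
  qed (auto simp: F_obj L F_in)
  moreover have "bij_betw (\<Phi> X Y) (Hom C (L X) Y) (Hom D X (on_obj G Y))"
    if "X \<in> Obj D" "Y \<in> Obj C" for X Y
  proof (rule bij_betwI[of _ _ _ "ext X Y"])
    show "ext X Y (\<Phi> X Y u) = u" if "u \<in> Hom C (L X) Y" for u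
      using that \<open>X \<in> _\<close> \<open>Y \<in> _\<close> by (intro eqI[of X Y]) (auto simp: ext \<Phi>_in)
  qed (use that \<Phi>_in ext in auto)
  ultimately have "adjunction C D F G \<Phi>"
    by (intro adjunction.intro adjunction_axioms.intro assms(1))
      (auto simp: F_obj natural \<Phi>_Comp)
  then show ?thesis by (auto simp: has_left_adjoint_def)
qed


section \<open>The algebras are finite rings\<close>

lemma path_products:
  "{(u, v). path_comp u v = Some Pe} = {(Pe, Pe)}"
  "{(u, v). path_comp u v = Some Pf} = {(Pf, Pf)}"
  "{(u, v). path_comp u v = Some Pa} = {(Pe, Pa), (Pa, Pf)}"
proof -
  have "path_comp u v = Some w \<longleftrightarrow>
      (u, v, w) \<in> {(Pe, Pe, Pe), (Pf, Pf, Pf), (Pe, Pa, Pa), (Pa, Pf, Pa)}" for u v w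
    by (cases u; cases v; cases w) simp_all
  then show "{(u, v). path_comp u v = Some Pe} = {(Pe, Pe)}"
    "{(u, v). path_comp u v = Some Pf} = {(Pf, Pf)}"
    "{(u, v). path_comp u v = Some Pa} = {(Pe, Pa), (Pa, Pf)}"
    by auto
qed

text \<open>This is multiplication of upper triangular 2 by 2 matrices with diagonal entries at
  \<open>Pe\<close> and \<open>Pf\<close> and corner entry at \<open>Pa\<close>. The ring axioms are
  then verified entry by entry.\<close>

lemma path_algebra_mult:
  assumes "ring S" and "\<And>w. x w \<in> carrier S" and "\<And>w. y w \<in> carrier S"
  shows "(x \<otimes>\<^bsub>path_algebra S\<^esub> y) Pe = x Pe \<otimes>\<^bsub>S\<^esub> y Pe"
    and "(x \<otimes>\<^bsub>path_algebra S\<^esub> y) Pf = x Pf \<otimes>\<^bsub>S\<^esub> y Pf"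
    and "(x \<otimes>\<^bsub>path_algebra S\<^esub> y) Pa = x Pe \<otimes>\<^bsub>S\<^esub> y Pa \<oplus>\<^bsub>S\<^esub> x Pa \<otimes>\<^bsub>S\<^esub> y Pf"
proof -
  interpret S: ring S by fact
  show "(x \<otimes>\<^bsub>path_algebra S\<^esub> y) Pe = x Pe \<otimes>\<^bsub>S\<^esub> y Pe"
    and "(x \<otimes>\<^bsub>path_algebra S\<^esub> y) Pf = x Pf \<otimes>\<^bsub>S\<^esub> y Pf"
    and "(x \<otimes>\<^bsub>path_algebra S\<^esub> y) Pa = x Pe \<otimes>\<^bsub>S\<^esub> y Pa \<oplus>\<^bsub>S\<^esub> x Pa \<otimes>\<^bsub>S\<^esub> y Pf"
    using assms(2,3) by (simp_all add: path_algebra_def path_products)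
qed

lemma path_algebra_simps:
  "carrier (path_algebra S) = {x. \<forall>w. x w \<in> carrier S}"
  "\<one>\<^bsub>path_algebra S\<^esub> = (\<lambda>w. if w = Pa then \<zero>\<^bsub>S\<^esub> else \<one>\<^bsub>S\<^esub>)"
  "\<zero>\<^bsub>path_algebra S\<^esub> = (\<lambda>w. \<zero>\<^bsub>S\<^esub>)"
  "x \<oplus>\<^bsub>path_algebra S\<^esub> y = (\<lambda>w. x w \<oplus>\<^bsub>S\<^esub> y w)"
  by (simp_all add: path_algebra_def)

lemma ring_path_algebra:
  assumes "ring S"
  shows "ring (path_algebra S)"
proof -
  interpret S: ring S by fact
  let ?A = "path_algebra S"
  note mult = path_algebra_mult[OF assms]
  have all: "(\<forall>w. Q w) \<longleftrightarrow> Q Pe \<and> Q Pf \<and> Q Pa" for Q :: "path \<Rightarrow> bool"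
    by (metis path.exhaust)
  have closed: "x \<otimes>\<^bsub>?A\<^esub> y \<in> carrier ?A" if "x \<in> carrier ?A" "y \<in> carrier ?A" for x y
  proof -
    have "\<And>w. x w \<in> carrier S" "\<And>w. y w \<in> carrier S" using that by (auto simp: path_algebra_simps)
    then show ?thesis by (simp add: path_algebra_simps(1) all mult)
  qed
  have mem: "x w \<in> carrier S" if "x \<in> carrier ?A" for x w
    using that by (simp add: path_algebra_simps)
  have eqI: "x = y" if "x Pe = y Pe" "x Pf = y Pf" "x Pa = y Pa" for x y :: "path \<Rightarrow> 'a"
    using that by (metis (full_types) ext path.exhaust)
  have "abelian_group ?A"
  proof (rule abelian_groupI, goal_cases)
    case (6 x)
    then show ?case
      by (intro bexI[of _ "\<lambda>w. \<ominus>\<^bsub>S\<^esub> x w"]) (auto simp: path_algebra_simps S.l_neg)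
  qed (auto simp: path_algebra_simps S.a_ac)
  moreover have one: "\<one>\<^bsub>?A\<^esub> \<in> carrier ?A" by (simp add: path_algebra_simps)
  have "monoid ?A"
  proof (rule monoidI)
    fix x y z assume x: "x \<in> carrier ?A" and y: "y \<in> carrier ?A" and z: "z \<in> carrier ?A"
    show "x \<otimes>\<^bsub>?A\<^esub> y \<otimes>\<^bsub>?A\<^esub> z = x \<otimes>\<^bsub>?A\<^esub> (y \<otimes>\<^bsub>?A\<^esub> z)"
      using x y z closed[OF x y] closed[OF y z]
      by (intro eqI) (simp_all add: mult mem S.m_assoc S.l_distr S.r_distr S.a_assoc)
  next
    fix x assume x: "x \<in> carrier ?A"
    have one_w: "\<one>\<^bsub>?A\<^esub> Pe = \<one>\<^bsub>S\<^esub>" "\<one>\<^bsub>?A\<^esub> Pf = \<one>\<^bsub>S\<^esub>" "\<one>\<^bsub>?A\<^esub> Pa = \<zero>\<^bsub>S\<^esub>"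
      by (simp_all add: path_algebra_simps)
    show "\<one>\<^bsub>?A\<^esub> \<otimes>\<^bsub>?A\<^esub> x = x"
      by (rule eqI) (simp_all add: mult mem[OF one] mem[OF x] one_w)
    show "x \<otimes>\<^bsub>?A\<^esub> \<one>\<^bsub>?A\<^esub> = x"
      by (rule eqI) (simp_all add: mult mem[OF one] mem[OF x] one_w)
  qed (use closed one in auto)
  moreover have add: "x \<oplus>\<^bsub>?A\<^esub> y \<in> carrier ?A" if "x \<in> carrier ?A" "y \<in> carrier ?A" for x y
    using that by (simp add: path_algebra_simps)
  have addw: "(x \<oplus>\<^bsub>?A\<^esub> y) w = x w \<oplus>\<^bsub>S\<^esub> y w" for x y w by (simp add: path_algebra_simps)
  have "(x \<oplus>\<^bsub>?A\<^esub> y) \<otimes>\<^bsub>?A\<^esub> z = x \<otimes>\<^bsub>?A\<^esub> z \<oplus>\<^bsub>?A\<^esub> y \<otimes>\<^bsub>?A\<^esub> z"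
    if "x \<in> carrier ?A" "y \<in> carrier ?A" "z \<in> carrier ?A" for x y z
    using that add[OF that(1,2)]
    by (intro eqI) (simp_all add: addw mult mem S.l_distr S.a_ac)
  moreover have "z \<otimes>\<^bsub>?A\<^esub> (x \<oplus>\<^bsub>?A\<^esub> y) = z \<otimes>\<^bsub>?A\<^esub> x \<oplus>\<^bsub>?A\<^esub> z \<otimes>\<^bsub>?A\<^esub> y"
    if "x \<in> carrier ?A" "y \<in> carrier ?A" "z \<in> carrier ?A" for x y z
    using that add[OF that(1,2)]
    by (intro eqI) (simp_all add: addw mult mem S.r_distr S.a_ac)
  ultimately show ?thesis by (intro ringI)
qed

lemma finite_path_algebra:
  assumes "finite (carrier S)"
  shows "finite (carrier (path_algebra S))"
proof -
  have "finite (UNIV :: path set)"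
    by (rule finite_subset[of _ "{Pe, Pf, Pa}"]) (auto intro: path.exhaust)
  then have "finite ((UNIV :: path set) \<rightarrow>\<^sub>E carrier S)" using assms by (intro finite_PiE)
  then show ?thesis by (rule rev_finite_subset) (auto simp: path_algebra_def)
qed

text \<open>Division by the k-th power of the variable is a shift of coefficients, so every coset
  contains the truncation of its representative below degree \<open>k\<close>. Over a finite ring
  there are finitely many truncations.\<close>

lemma (in UP_cring) finite_truncated_polynomials:
  assumes "finite (carrier R)"
  shows "finite (carrier (P Quot (PIdl\<^bsub>P\<^esub> (monom P \<one> 1 [^]\<^bsub>P\<^esub> (k :: nat)))))"
proof -
  interpret P: cring P by (rule UP_cring)
  let ?X = "monom P \<one> k"
  let ?I = "PIdl\<^bsub>P\<^esub> ?X"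
  have pow: "monom P \<one> 1 [^]\<^bsub>P\<^esub> k = ?X" using monom_pow[of \<one> 1 k] by simp
  have X: "?X \<in> carrier P" by simp
  interpret I: ideal ?I P by (rule P.cgenideal_ideal[OF X])
  define trunc where "trunc c = (\<lambda>m. if m < k then c m else \<zero>)" for c :: "nat \<Rightarrow> 'a"
  have coeff: "coeff P f n = f n" if "f \<in> carrier P" for f n
    using that by (simp add: P_def UP_def)
  have "?I +>\<^bsub>P\<^esub> f = ?I +>\<^bsub>P\<^esub> trunc f" if f: "f \<in> carrier P" for f
  proof -
    have f_mem: "f n \<in> carrier R" for n using coeff_closed[OF f, of n] by (simp add: coeff f)
    obtain b where b: "\<And>m. b < m \<Longrightarrow> f m = \<zero>"
      using f by (auto simp: P_def UP_def up_def bound_def)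
    have r: "trunc f \<in> carrier P"
      using f_mem by (auto simp: trunc_def P_def UP_def up_def intro!: exI[of _ k] bound.intro)
    \<comment> \<open>The quotient is the sequence shifted by \<open>k\<close>; the bound
      \<open>b\<close> for \<open>f\<close> also bounds it.\<close>
    have v: "(\<lambda>m. f (m + k)) \<in> carrier P"
      using f_mem b by (auto simp: P_def UP_def up_def intro!: exI[of _ b] bound.intro)
    let ?v = "\<lambda>m. f (m + k)"
    have eq: "f = ?X \<otimes>\<^bsub>P\<^esub> ?v \<oplus>\<^bsub>P\<^esub> trunc f"
    proof (rule up_eqI)
      fix n
      show "coeff P f n = coeff P (?X \<otimes>\<^bsub>P\<^esub> ?v \<oplus>\<^bsub>P\<^esub> trunc f) n"
      proof (cases "n < k")
        case True
        \<comment> \<open>Every summand contains a coefficient of the monomial at an index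
          \<open>i \<le> n < k\<close>, hence zero.\<close>
        have "coeff P (?X \<otimes>\<^bsub>P\<^esub> ?v) n = (\<Oplus>i\<in>{..n}. coeff P ?X i \<otimes> coeff P ?v (n - i))"
          by (rule coeff_mult[OF X v])
        also have "\<dots> = (\<Oplus>i\<in>{..n}. \<zero>)"
          using True v by (intro R.finsum_cong') (auto simp: coeff_closed)
        finally have "coeff P (?X \<otimes>\<^bsub>P\<^esub> ?v) n = \<zero>" by (simp add: R.finsum_zero)
        then show ?thesis
          using True f r v X f_mem by (simp add: coeff[OF f] coeff[OF r]) (simp add: trunc_def)
      next
        case False
        then have "coeff P (?X \<otimes>\<^bsub>P\<^esub> ?v) n = f n"
          using coeff_monom_mult[OF R.one_closed v, of k "n - k"] f_mem by (simp add: coeff[OF v])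
        then show ?thesis
          using False f r v X f_mem by (simp add: coeff[OF f] coeff[OF r]) (simp add: trunc_def)
      qed
    qed (use f r v X in simp_all)
    have "?X \<otimes>\<^bsub>P\<^esub> ?v \<in> ?I"
      unfolding cgenideal_def using v P.m_comm[OF X v] by blast
    then have "?X \<otimes>\<^bsub>P\<^esub> ?v \<oplus>\<^bsub>P\<^esub> trunc f \<in> ?I +>\<^bsub>P\<^esub> trunc f"
      by (auto simp: a_r_coset_def')
    then have "f \<in> ?I +>\<^bsub>P\<^esub> trunc f" unfolding eq[symmetric] .
    then show ?thesis by (rule I.a_repr_independence'[OF _ r, symmetric])
  qed
  moreover have "trunc f \<in> trunc ` ({..<k} \<rightarrow>\<^sub>E carrier R)" if "f \<in> carrier P" for f
    using coeff_closed[OF that]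
    by (intro image_eqI[of _ _ "restrict f {..<k}"]) (auto simp: trunc_def coeff[OF that])
  ultimately have "carrier (P Quot ?I) \<subseteq> (\<lambda>r. ?I +>\<^bsub>P\<^esub> r) ` trunc ` ({..<k} \<rightarrow>\<^sub>E carrier R)"
    by (auto simp: FactRing_def A_RCOSETS_def')
  then show ?thesis
    unfolding pow by (rule finite_subset) (use assms in \<open>auto intro!: finite_PiE\<close>)
qed

section \<open>From the residue ring to the quotients of the path algebra\<close>

lemma UP_cring_residue_ring:
  assumes "prime p"
  shows "UP_cring (residue_ring (int p))" and "finite (carrier (residue_ring (int p)))"
proof -
  have "residues (int p)" using prime_gt_1_nat[OF assms] by unfold_locales simp
  then show "UP_cring (residue_ring (int p))" "finite (carrier (residue_ring (int p)))"
    by (auto intro: residues.cring residues.finite UP_cring.intro)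
qed

lemma ideal_pi_cubed:
  assumes "prime p"
  shows "ideal (pi_cubed p) (poly_Fp p)"
proof -
  interpret UP_cring "residue_ring (int p)" "poly_Fp p"
    by (rule UP_cring_residue_ring[OF assms] | simp add: poly_Fp_def)+
  interpret P: cring "poly_Fp p" by (rule UP_cring)
  show ?thesis unfolding pi_cubed_def poly_X_def by (intro P.cgenideal_ideal) simp
qed

lemma ring_scalars: "prime p \<Longrightarrow> ring (scalars p)"
  unfolding scalars_def by (rule ideal.quotient_is_ring[OF ideal_pi_cubed])

lemma finite_scalars:
  assumes "prime p"
  shows "finite (carrier (scalars p))"
  using UP_cring.finite_truncated_polynomials[OF UP_cring_residue_ring[OF assms], of 3]
  by (simp add: scalars_def pi_cubed_def poly_X_def poly_Fp_def)

text \<open>The relators have to lie in the algebra for the set they generate to be an ideal, and so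
  for the quotient to be a ring.\<close>

lemma relators_closed:
  assumes "prime p"
  shows "relators p j \<subseteq> carrier (A_alg p)"
proof -
  interpret UP_cring "residue_ring (int p)" "poly_Fp p"
    by (rule UP_cring_residue_ring[OF assms] | simp add: poly_Fp_def)+
  interpret S: ring "scalars p" by (rule ring_scalars[OF assms])
  have "pi_class p \<in> carrier (scalars p)"
    unfolding pi_class_def scalars_def poly_X_def
    by (auto simp: FactRing_def A_RCOSETS_def' )
  then have "pi_path p k w \<in> carrier (A_alg p)" for k w
    by (simp add: pi_path_def path_elem_def A_alg_def path_algebra_simps)
  then show ?thesis by (auto simp: relators_def)
qed

lemma
  assumes "prime p"
  shows ring_C_alg: "ring (C_alg p j)" and finite_C_alg: "finite (carrier (C_alg p j))"
proof -
  interpret A: ring "A_alg p"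
    unfolding A_alg_def by (rule ring_path_algebra[OF ring_scalars[OF assms]])
  interpret I: ideal "Idl\<^bsub>A_alg p\<^esub> (relators p j)" "A_alg p"
    by (rule A.genideal_ideal[OF relators_closed[OF assms]])
  show "ring (C_alg p j)" unfolding C_alg_def by (rule I.quotient_is_ring)
  have "finite (carrier (A_alg p))"
    unfolding A_alg_def by (rule finite_path_algebra[OF finite_scalars[OF assms]])
  then show "finite (carrier (C_alg p j))"
    by (simp add: C_alg_def FactRing_def A_RCOSETS_def')
qed


section \<open>The left adjoint\<close>

locale finite_ring_syzygies = finite_ring_stable R "TYPE('m)" + syzygies R S
  for R :: "'a ring" and S :: "('a, 'm) syzygies"
begin

text \<open>The universal property is stated for maps rather than stable classes: the last two
  conclusions are existence and uniqueness modulo projectives. Each \<open>h\<close> comes with a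
  morphism of sequences, so that \<open>h'\<close> represents its image under the Heller
  operator.\<close>

lemma heller_universal_arrow:
  assumes X: "X \<in> fgm"
  obtains Z \<eta> where "Z \<in> fgm" and "\<eta> \<in> mod_hom R X (syz S Z)"
    and "\<And>Y f. Y \<in> fgm \<Longrightarrow> f \<in> mod_hom R X (syz S Y) \<Longrightarrow>
      \<exists>h h' k. ses_morphism R S Z Y h' k h \<and>
        (compose (carrier X) h' \<eta>, f) \<in> stable_rel R X (syz S Y)"
    and "\<And>Y h1 h1' k1 h2 h2' k2.
      \<lbrakk>Y \<in> fgm; ses_morphism R S Z Y h1' k1 h1; ses_morphism R S Z Y h2' k2 h2;
        (compose (carrier X) h1' \<eta>, compose (carrier X) h2' \<eta>) \<in> stable_rel R X (syz S Y)\<rbrakk>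
      \<Longrightarrow> (h1, h2) \<in> stable_rel R Z Y"
proof -
  obtain P i where P: "P \<in> fgm" "projective_module R P" and i: "i \<in> mod_hom R X P"
    and extend: "\<And>Q f. \<lbrakk>Q \<in> fgm; projective_module R Q; f \<in> mod_hom R X Q\<rbrakk>
        \<Longrightarrow> \<exists>g \<in> mod_hom R P Q. \<forall>x\<in>carrier X. f x = g (i x)"
    by (rule left_projective_approximation[OF X]) blast
  obtain Z q where Z': "right_module R Z" and q: "q \<in> mod_hom R P Z"
    and q_surj: "q ` carrier P = carrier Z"
    and q_ker: "\<And>x. x \<in> carrier P \<Longrightarrow> q x = \<zero>\<^bsub>Z\<^esub> \<longleftrightarrow> x \<in> i ` carrier X"
    by (rule cokernel_exists[OF right_module_fg[OF X] right_module_fg[OF P(1)] i]) blast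
  have Z: "Z \<in> fgm"
    using Z' P(1) by (auto simp: fg_module_iff q_surj[symmetric])
  note [simp] = X P Z syz_fg cov_fg right_module_fg projective_cov
  have qi: "q (i x) = \<zero>\<^bsub>Z\<^esub>" if "x \<in> carrier X" for x
    using that by (simp add: q_ker mod_hom_closed[OF i])
  have factor: "\<exists>h\<in>mod_hom R Z Y. \<forall>x\<in>carrier P. h (q x) = g x"
    if "Y \<in> fgm" "g \<in> mod_hom R P Y" "\<And>x. x \<in> carrier X \<Longrightarrow> g (i x) = \<zero>\<^bsub>Y\<^esub>" for Y g
  proof -
    have "g x = \<zero>\<^bsub>Y\<^esub>" if "x \<in> carrier P" "q x = \<zero>\<^bsub>Z\<^esub>" for x
      using that q_ker \<open>\<And>x. x \<in> carrier X \<Longrightarrow> g (i x) = \<zero>\<^bsub>Y\<^esub>\<close> by auto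
    with that(1) show ?thesis
      using cokernel_factor[OF _ _ _ q q_surj that(2)] by (metis right_module_fg P(1) Z)
  qed
  \<comment> \<open>The lift \<open>t\<close> of the cokernel map sends the image of
    \<open>X\<close> into the kernel of \<open>prj S Z\<close>; its restriction to \<open>X\<close>
    is \<open>\<eta>\<close>.\<close>
  obtain t where t: "t \<in> mod_hom R P (cov S Z)"
    and prj_t: "\<And>x. x \<in> carrier P \<Longrightarrow> prj S Z (t x) = q x"
    by (rule lift_through_prj[OF P Z q]) blast
  have "compose (carrier X) t i \<in> mod_hom R X (cov S Z)"
    by (rule compose_mod_hom[OF _ i t]) simp
  moreover have "prj S Z (compose (carrier X) t i x) = \<zero>\<^bsub>Z\<^esub>" if "x \<in> carrier X" for x
    using that by (simp add: compose_def prj_t qi mod_hom_closed[OF i])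
  ultimately obtain \<eta> where \<eta>: "\<eta> \<in> mod_hom R X (syz S Z)"
    and "\<And>x. x \<in> carrier X \<Longrightarrow> inc S Z (\<eta> x) = compose (carrier X) t i x"
    using factor_through_inc[OF X Z] by metis
  then have inc_\<eta>: "inc S Z (\<eta> x) = t (i x)" if "x \<in> carrier X" for x
    using that by (simp add: compose_def)
  show thesis
  proof (rule that[OF Z \<eta>])
    fix Y f assume Y [simp]: "Y \<in> fgm" and f: "f \<in> mod_hom R X (syz S Y)"
    interpret Y: abelian_group Y by (rule abelian_group_fg) simp
    interpret cY: abelian_group "cov S Y" by (rule abelian_group_fg) simp
    interpret sY: abelian_group "syz S Y" by (rule abelian_group_fg) simp
    \<comment> \<open>The composite lands in a projective, so it extends along \<open>i\<close> to
      \<open>g\<close>. Then \<open>g\<close> followed by \<open>prj S Y\<close> kills the image of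
      \<open>X\<close> and induces \<open>h\<close>.\<close>
    have "compose (carrier X) (inc S Y) f \<in> mod_hom R X (cov S Y)"
      by (rule compose_mod_hom[OF _ f inc_hom]) simp_all
    then obtain g where g: "g \<in> mod_hom R P (cov S Y)"
      and "\<forall>x\<in>carrier X. compose (carrier X) (inc S Y) f x = g (i x)"
      using extend[of "cov S Y"] by auto
    then have gi: "g (i x) = inc S Y (f x)" if "x \<in> carrier X" for x
      using that by (simp add: compose_def)
    have "compose (carrier P) (prj S Y) g \<in> mod_hom R P Y"
      by (rule compose_mod_hom[OF _ g prj_hom]) simp_all
    moreover have "compose (carrier P) (prj S Y) g (i x) = \<zero>\<^bsub>Y\<^esub>" if "x \<in> carrier X" for x
      using that by (simp add: compose_def gi mod_hom_closed[OF i] prj_inc mod_hom_closed[OF f])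
    ultimately obtain h where h: "h \<in> mod_hom R Z Y"
      and "\<forall>x\<in>carrier P. h (q x) = compose (carrier P) (prj S Y) g x"
      using factor[OF Y] by blast
    then have hq: "h (q x) = prj S Y (g x)" if "x \<in> carrier P" for x
      using that by (simp add: compose_def)
    obtain h' k where ses: "ses_morphism R S Z Y h' k h" by (rule ses_morphism_exists[OF Z Y h])
    then have h': "h' \<in> mod_hom R (syz S Z) (syz S Y)" and k: "k \<in> mod_hom R (cov S Z) (cov S Y)"
      and k1: "\<And>x. x \<in> carrier (syz S Z) \<Longrightarrow> k (inc S Z x) = inc S Y (h' x)"
      and k2: "\<And>x. x \<in> carrier (cov S Z) \<Longrightarrow> h (prj S Z x) = prj S Y (k x)"
      by (auto simp: ses_morphism_def)
    have h'\<eta>: "compose (carrier X) h' \<eta> \<in> mod_hom R X (syz S Y)"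
      by (rule compose_mod_hom[OF _ \<eta> h']) simp
    have kt: "compose (carrier P) k t \<in> mod_hom R P (cov S Y)"
      by (rule compose_mod_hom[OF _ t k]) simp
    \<comment> \<open>Both \<open>k\<close> after \<open>t\<close> and \<open>g\<close> lift
      \<open>h\<close> after \<open>q\<close>, so \<open>d\<close> lands in the syzygy of
      \<open>Y\<close>. On \<open>X\<close> it becomes the difference of \<open>h' \<eta>\<close>
      and \<open>f\<close>, which therefore factors over \<open>P\<close> as \<open>s\<close> after
      \<open>i\<close>.\<close>
    define d where "d = (\<lambda>x\<in>carrier P. compose (carrier P) k t x \<ominus>\<^bsub>cov S Y\<^esub> g x)"
    have d: "d \<in> mod_hom R P (cov S Y)"
      unfolding d_def by (rule diff_mod_hom[OF _ _ kt g]) simp_all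
    have d_eq: "d x = k (t x) \<ominus>\<^bsub>cov S Y\<^esub> g x" if "x \<in> carrier P" for x
      using that by (simp add: d_def compose_def)
    have "prj S Y (d x) = \<zero>\<^bsub>Y\<^esub>" if x: "x \<in> carrier P" for x
    proof -
      have "prj S Y (d x) = prj S Y (k (t x)) \<ominus>\<^bsub>Y\<^esub> prj S Y (g x)"
        using x mod_hom_closed[OF t] mod_hom_closed[OF k] mod_hom_closed[OF g]
        by (simp add: d_eq hom_minus[OF _ _ prj_hom])
      also have "prj S Y (k (t x)) = prj S Y (g x)"
        using x mod_hom_closed[OF t x] by (simp add: k2[symmetric] prj_t hq)
      finally show ?thesis
        using x mod_hom_closed[OF g x] mod_hom_closed[OF prj_hom[OF Y]]
        by (simp add: Y.minus_eq_zero_iff)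
    qed
    then obtain s where s: "s \<in> mod_hom R P (syz S Y)"
      and inc_s: "\<And>x. x \<in> carrier P \<Longrightarrow> inc S Y (s x) = d x"
      using factor_through_inc[OF P(1) Y d] by blast
    have "(compose (carrier X) h' \<eta>, f) \<in> stable_rel R X (syz S Y)"
    proof (rule stable_relI[OF X P h'\<eta> f i s])
      fix x assume x: "x \<in> carrier X"
      note m = mod_hom_closed[OF i x] mod_hom_closed[OF \<eta> x] mod_hom_closed[OF f x]
      have "inc S Y (h' (\<eta> x) \<ominus>\<^bsub>syz S Y\<^esub> f x) = k (inc S Z (\<eta> x)) \<ominus>\<^bsub>cov S Y\<^esub> g (i x)"
        using m x by (simp add: hom_minus[OF _ _ inc_hom] mod_hom_closed[OF h'] k1 gi)
      also have "\<dots> = inc S Y (s (i x))"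
        using m x by (simp add: inc_s d_eq inc_\<eta>)
      finally have "h' (\<eta> x) \<ominus>\<^bsub>syz S Y\<^esub> f x = s (i x)"
        using m by - (rule inj_onD[OF inc_inj[OF Y]],
          simp_all add: sY.minus_closed mod_hom_closed[OF h'] mod_hom_closed[OF s])
      then show "compose (carrier X) h' \<eta> x \<ominus>\<^bsub>syz S Y\<^esub> f x = s (i x)"
        using x by (simp add: compose_def)
    qed
    with ses show "\<exists>h h' k. ses_morphism R S Z Y h' k h \<and>
        (compose (carrier X) h' \<eta>, f) \<in> stable_rel R X (syz S Y)" by blast
  next
    fix Y h1 h1' k1 h2 h2' k2
    assume Y [simp]: "Y \<in> fgm" and ses1: "ses_morphism R S Z Y h1' k1 h1"
      and ses2: "ses_morphism R S Z Y h2' k2 h2"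
      and rel: "(compose (carrier X) h1' \<eta>, compose (carrier X) h2' \<eta>) \<in> stable_rel R X (syz S Y)"
    interpret Y: abelian_group Y by (rule abelian_group_fg) simp
    interpret cY: abelian_group "cov S Y" by (rule abelian_group_fg) simp
    from ses1 have h1': "h1' \<in> mod_hom R (syz S Z) (syz S Y)"
      and k1: "k1 \<in> mod_hom R (cov S Z) (cov S Y)"
      and h1: "h1 \<in> mod_hom R Z Y"
      and a1: "\<And>x. x \<in> carrier (syz S Z) \<Longrightarrow> k1 (inc S Z x) = inc S Y (h1' x)"
      and b1: "\<And>x. x \<in> carrier (cov S Z) \<Longrightarrow> h1 (prj S Z x) = prj S Y (k1 x)"
      by (auto simp: ses_morphism_def)
    from ses2 have h2': "h2' \<in> mod_hom R (syz S Z) (syz S Y)"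
      and k2: "k2 \<in> mod_hom R (cov S Z) (cov S Y)"
      and h2: "h2 \<in> mod_hom R Z Y"
      and a2: "\<And>x. x \<in> carrier (syz S Z) \<Longrightarrow> k2 (inc S Z x) = inc S Y (h2' x)"
      and b2: "\<And>x. x \<in> carrier (cov S Z) \<Longrightarrow> h2 (prj S Z x) = prj S Y (k2 x)"
      by (auto simp: ses_morphism_def)
    from rel obtain Q u v where Q: "Q \<in> fgm" "projective_module R Q"
      and u: "u \<in> mod_hom R X Q" and v: "v \<in> mod_hom R Q (syz S Y)"
      and uv: "\<And>x. x \<in> carrier X \<Longrightarrow>
        compose (carrier X) h1' \<eta> x \<ominus>\<^bsub>syz S Y\<^esub> compose (carrier X) h2' \<eta> x = v (u x)"
      unfolding stable_rel_def by blast
    \<comment> \<open>The projective \<open>Q\<close> supplied by the stable relation is arbitrary;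
      extending \<open>u\<close> along \<open>i\<close> replaces it by \<open>P\<close>, where the
      comparison with \<open>t\<close> takes place.\<close>
    obtain w where w: "w \<in> mod_hom R P Q" and wi: "\<And>x. x \<in> carrier X \<Longrightarrow> u x = w (i x)"
      using extend[OF Q u] by blast
    define d where "d = (\<lambda>x\<in>carrier (cov S Z). k1 x \<ominus>\<^bsub>cov S Y\<^esub> k2 x)"
    have d: "d \<in> mod_hom R (cov S Z) (cov S Y)"
      unfolding d_def by (rule diff_mod_hom[OF _ _ k1 k2]) simp_all
    have dt: "compose (carrier P) d t \<in> mod_hom R P (cov S Y)"
      by (rule compose_mod_hom[OF _ t d]) simp
    have "compose (carrier P) (inc S Y) (compose (carrier P) v w) \<in> mod_hom R P (cov S Y)"
      (is "?ivw \<in> _")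
      by (rule compose_mod_hom[OF _ compose_mod_hom[OF _ w v] inc_hom]) simp_all
    \<comment> \<open>Subtracting the correction makes the map vanish on the image of
      \<open>X\<close>, so that it descends along \<open>q\<close> to a map from \<open>Z\<close> to
      the cover of \<open>Y\<close>.\<close>
    define g where "g = (\<lambda>x\<in>carrier P. compose (carrier P) d t x \<ominus>\<^bsub>cov S Y\<^esub> ?ivw x)"
    have g: "g \<in> mod_hom R P (cov S Y)"
      unfolding g_def by (rule diff_mod_hom[OF _ _ dt \<open>?ivw \<in> _\<close>]) simp_all
    have g_eq: "g x = (k1 (t x) \<ominus>\<^bsub>cov S Y\<^esub> k2 (t x)) \<ominus>\<^bsub>cov S Y\<^esub> inc S Y (v (w x))"
      if "x \<in> carrier P" for x
      using that mod_hom_closed[OF t that] by (simp add: g_def d_def compose_def)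
    have "g (i x) = \<zero>\<^bsub>cov S Y\<^esub>" if x: "x \<in> carrier X" for x
    proof -
      note m = mod_hom_closed[OF i x] mod_hom_closed[OF \<eta> x]
      have "k1 (t (i x)) \<ominus>\<^bsub>cov S Y\<^esub> k2 (t (i x)) = inc S Y (h1' (\<eta> x) \<ominus>\<^bsub>syz S Y\<^esub> h2' (\<eta> x))"
        using m x by (simp add: inc_\<eta>[symmetric] a1 a2 hom_minus[OF _ _ inc_hom]
            mod_hom_closed[OF h1'] mod_hom_closed[OF h2'])
      also have "h1' (\<eta> x) \<ominus>\<^bsub>syz S Y\<^esub> h2' (\<eta> x) = v (w (i x))"
        using uv[OF x] wi[OF x] x by (simp add: compose_def)
      finally show ?thesis
        using m mod_hom_closed[OF w m(1)] mod_hom_closed[OF v] mod_hom_closed[OF inc_hom[OF Y]]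
        by (simp add: g_eq cY.minus_eq_zero_iff)
    qed
    then obtain k where k: "k \<in> mod_hom R Z (cov S Y)" and kq: "\<And>x. x \<in> carrier P \<Longrightarrow> k (q x) = g x"
      using factor[OF cov_fg[OF Y] g] by blast
    show "(h1, h2) \<in> stable_rel R Z Y"
    proof (rule stable_relI[OF Z cov_fg[OF Y] projective_cov[OF Y] h1 h2 k prj_hom[OF Y]])
      fix z assume "z \<in> carrier Z"
      then obtain x where x: "x \<in> carrier P" and z: "z = q x" using q_surj by auto
      note m = mod_hom_closed[OF t x] mod_hom_closed[OF w x]
      note m' = mod_hom_closed[OF k1 m(1)] mod_hom_closed[OF k2 m(1)] mod_hom_closed[OF v m(2)]
      \<comment> \<open>The correction passes through \<open>inc S Y\<close> and is killed by
        \<open>prj S Y\<close>; the other two terms give \<open>h1\<close> and \<open>h2\<close>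
        because \<open>t\<close> lifts \<open>q\<close>.\<close>
      have "prj S Y (k z) = (prj S Y (k1 (t x)) \<ominus>\<^bsub>Y\<^esub> prj S Y (k2 (t x))) \<ominus>\<^bsub>Y\<^esub> \<zero>\<^bsub>Y\<^esub>"
        using m' x by (simp add: z kq g_eq hom_minus[OF _ _ prj_hom[OF Y]] cY.minus_closed
            mod_hom_closed[OF inc_hom[OF Y]] prj_inc)
      also have "\<dots> = h1 z \<ominus>\<^bsub>Y\<^esub> h2 z"
        using m m' x mod_hom_closed[OF h1] mod_hom_closed[OF h2] mod_hom_closed[OF prj_hom[OF Y]]
        by (simp add: z b1[symmetric] b2[symmetric] prj_t Y.minus_eq mod_hom_closed[OF q])
      finally show "h1 z \<ominus>\<^bsub>Y\<^esub> h2 z = prj S Y (k z)" ..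
    qed
  qed
qed

text \<open>What remains is the passage to stable classes: since any morphism of sequences over
  \<open>h\<close> computes the image of its class, composing that image with the class of
  \<open>\<eta>\<close> gives the class of \<open>h' \<eta>\<close>.\<close>

theorem heller_has_left_adjoint: "has_left_adjoint (stable_mod R) (stable_mod R) (heller R S)"
proof (rule has_left_adjoint_if_universal_arrows[OF heller_is_functor])
  fix X :: "('a, 'm) module" assume "X \<in> Obj (stable_mod R)"
  then have X: "X \<in> fgm" by (simp add: stable_mod_simps)
  obtain Z \<eta> where Z: "Z \<in> fgm" and \<eta>: "\<eta> \<in> mod_hom R X (syz S Z)"
    and ex: "\<And>Y f. Y \<in> fgm \<Longrightarrow> f \<in> mod_hom R X (syz S Y) \<Longrightarrow>
      \<exists>h h' k. ses_morphism R S Z Y h' k h \<and>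
        (compose (carrier X) h' \<eta>, f) \<in> stable_rel R X (syz S Y)"
    and uniq: "\<And>Y h1 h1' k1 h2 h2' k2.
      \<lbrakk>Y \<in> fgm; ses_morphism R S Z Y h1' k1 h1; ses_morphism R S Z Y h2' k2 h2;
        (compose (carrier X) h1' \<eta>, compose (carrier X) h2' \<eta>) \<in> stable_rel R X (syz S Y)\<rbrakk>
      \<Longrightarrow> (h1, h2) \<in> stable_rel R Z Y"
    using heller_universal_arrow[OF X] by (metis (lifting))
  have obj: "on_obj (heller R S) = syz S" by (simp add: heller_def)
  let ?\<eta> = "stable_class R X (syz S Z) \<eta>"
  have comp: "Comp (stable_mod R) X (syz S Z) (syz S Y)
      (on_mor (heller R S) Z Y (stable_class R Z Y h)) ?\<eta>
      = stable_class R X (syz S Y) (compose (carrier X) h' \<eta>)"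
    and comp_hom: "compose (carrier X) h' \<eta> \<in> mod_hom R X (syz S Y)"
    and hom: "h \<in> mod_hom R Z Y"
    if "Y \<in> fgm" "ses_morphism R S Z Y h' k h" for Y h h' k
  proof -
    have h': "h' \<in> mod_hom R (syz S Z) (syz S Y)" using that(2) by (simp add: ses_morphism_def)
    show "Comp (stable_mod R) X (syz S Z) (syz S Y)
      (on_mor (heller R S) Z Y (stable_class R Z Y h)) ?\<eta>
      = stable_class R X (syz S Y) (compose (carrier X) h' \<eta>)"
      unfolding heller_stable_class[OF Z that]
      by (rule stable_Comp[OF X syz_fg[OF Z] syz_fg[OF that(1)] \<eta> h'])
    show "compose (carrier X) h' \<eta> \<in> mod_hom R X (syz S Y)"
      by (rule compose_mod_hom[OF right_module_fg[OF X] \<eta> h'])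
    show "h \<in> mod_hom R Z Y" using that(2) by (simp add: ses_morphism_def)
  qed
  show "\<exists>Z\<in>Obj (stable_mod R). \<exists>\<eta>\<in>Hom (stable_mod R) X (on_obj (heller R S) Z).
      \<forall>Y\<in>Obj (stable_mod R). \<forall>f\<in>Hom (stable_mod R) X (on_obj (heller R S) Y).
        \<exists>!h. h \<in> Hom (stable_mod R) Z Y \<and> Comp (stable_mod R) X (on_obj (heller R S) Z)
          (on_obj (heller R S) Y) (on_mor (heller R S) Z Y h) \<eta> = f"
    unfolding obj stable_mod_simps(1)
  proof (intro bexI[of _ Z] bexI[of _ ?\<eta>] ballI)
    fix Y F assume Y: "Y \<in> fgm" and "F \<in> Hom (stable_mod R) X (syz S Y)"
    then obtain f where f: "f \<in> mod_hom R X (syz S Y)" and F: "F = stable_class R X (syz S Y) f"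
      by (auto simp: stable_Hom_iff)
    obtain h h' k where ses: "ses_morphism R S Z Y h' k h"
      and rel: "(compose (carrier X) h' \<eta>, f) \<in> stable_rel R X (syz S Y)"
      using ex[OF Y f] by blast
    have eq: "stable_class R X (syz S Y) (compose (carrier X) h' \<eta>) = F"
      unfolding F using stable_class_eq_iff[OF X syz_fg[OF Y] comp_hom[OF Y ses] f] rel by blast
    show "\<exists>!H. H \<in> Hom (stable_mod R) Z Y \<and>
      Comp (stable_mod R) X (syz S Z) (syz S Y) (on_mor (heller R S) Z Y H) ?\<eta> = F"
    proof (rule ex1I[of _ "stable_class R Z Y h"], intro conjI)
      show "stable_class R Z Y h \<in> Hom (stable_mod R) Z Y"
        by (rule stable_class_in_Hom[OF hom[OF Y ses]])
      show "Comp (stable_mod R) X (syz S Z) (syz S Y)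
        (on_mor (heller R S) Z Y (stable_class R Z Y h)) ?\<eta> = F"
        unfolding comp[OF Y ses] by (rule eq)
      fix H assume H: "H \<in> Hom (stable_mod R) Z Y \<and>
        Comp (stable_mod R) X (syz S Z) (syz S Y) (on_mor (heller R S) Z Y H) ?\<eta> = F"
      then obtain h2 where h2: "h2 \<in> mod_hom R Z Y" and H2: "H = stable_class R Z Y h2"
        by (auto simp: stable_Hom_iff)
      obtain h2' k2 where ses2: "ses_morphism R S Z Y h2' k2 h2"
        by (rule ses_morphism_exists[OF Z Y h2])
      have "stable_class R X (syz S Y) (compose (carrier X) h2' \<eta>) = F"
        using H comp[OF Y ses2] H2 by simp
      then have "(compose (carrier X) h2' \<eta>, compose (carrier X) h' \<eta>) \<in> stable_rel R X (syz S Y)"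
        using stable_class_eq_iff[OF X syz_fg[OF Y] comp_hom[OF Y ses2] comp_hom[OF Y ses]] eq by
          simp
      then have "(h2, h) \<in> stable_rel R Z Y" by (rule uniq[OF Y ses2 ses])
      then show "H = stable_class R Z Y h"
        unfolding H2 using stable_class_eq_iff[OF Z Y h2 hom[OF Y ses]] by blast
    qed
  qed (use Z \<eta> in \<open>auto intro: stable_class_in_Hom\<close>)
qed

end

theorem proposition11:
  fixes p j :: nat
    and S :: "((path \<Rightarrow> scalar) set, 'm) syzygies"
  assumes "infinite (UNIV :: 'm set)"
    and "prime p" and "p \<in> {2..997}"
    and "j \<in> {1..8}"
    and "syzygy_choice (C_alg p j) S"
  shows "has_left_adjoint (stable_mod (C_alg p j)) (stable_mod (C_alg p j)) (heller (C_alg p j) S)"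
proof -
  interpret finite_ring_syzygies "C_alg p j" S
    using assms(1,5) ring_C_alg[OF assms(2)] finite_C_alg[OF assms(2)]
    by (intro finite_ring_syzygies.intro finite_ring_stable.intro syzygies.intro)
  show ?thesis by (rule heller_has_left_adjoint)
qed

end
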